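(* Let $X$ be a topological space, fix $q\ge 0$ and a field $k$, and let $f=(f_1,f_2)$ and $g=(g_1,g_2)$ be tame bipath functions on $X$ such that $$f_1^{-1}(\{-\infty\})=f_2^{-1}(\{-\infty\})=g_1^{-1}(\{-\infty\})=g_2^{-1}(\{-\infty\}).$$ Then $$d_{\mathrm{B}}^{\Lambda}\big(\mathscr{B}(V(f)),\mathscr{B}(V(g))\big)\le \|f,g\|_B .$$
   Context: The bipath poset $B$ has underlying set $(\mathbb{R}\times\{1,2\})\sqcup\{-\infty,+\infty\}$. Its order is: $x\le y$ iff $x=-\infty$, or $y=+\infty$, or $x=(s,i)$ and $y=(t,i)$ for the same $i\in\{1,2\}$ with $s\le t$. A $B$-persistence module $V$ over $k$ is a functor from $B$ (viewed as a category with a unique morphism $b\to b'$ iff $b\le b'$) to $k$-vector spaces. It consists of spaces $V_b$ and linear maps $V(b,b')$ for $b\le b'$; morphisms are natural transformations. $V$ is pfd if every $V_b$ is finite-dimensional. An interval of $B$ is a nonempty subset $I$ that is - convex: $p,q\in I$ and $p\le r\le q$ imply $r\in I$; and - connected: any two elements of $I$ are joined by a finite sequence of elements of $I$ with consecutive elements comparable. The interval module $k_I$ has $(k_I)_b=k$ for $b\in I$ and $0$ otherwise, with identity maps between elements of $I$ and zero maps otherwise. Every pfd $B$-persistence module decomposes, uniquely up to isomorphism and permutation of summands, into a direct sum of interval modules. $\mathscr{B}(V)$ denotes the resulting multiset of intervals. A bipath function on $X$ is a pair $(f_1,f_2)$ of maps $f_i\colon X\to(\mathbb{R}\times\{i\})\sqcup\{\pm\infty\}\subseteq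 B$ with $f_1^{-1}(\{-\infty\})=f_2^{-1}(\{-\infty\})$. Its sublevelset bipath filtration is - $(f\le -\infty)=f_1^{-1}(\{-\infty\})$, - $(f\le +\infty)=X$, - $(f\le (r,i))=\{x\in X: f_i(x)\le (r,i)\}$. This is an inclusion-ordered family indexed by $B$. $V(f)$ is the $B$-persistence module obtained by applying $H_q(-;k)$ to it, and $f$ is tame if $V(f)$ is pfd. For $b_1,b_2\in B$ set - $|b_1,b_2|_B=0$ if $b_1=b_2$; - $|b_1,b_2|_B=|r_1-r_2|$ if $b_1=(r_1,i)$ and $b_2=(r_2,i)$ for the same $i$; - $|b_1,b_2|_B=\infty$ otherwise. Then $\|f,g\|_B=\max_{i=1,2}\sup_{x\in X}|f_i(x),g_i(x)|_B$. For $\epsilon\ge0$ let $\Lambda_\epsilon\colon B\to B$ send $(r,i)\mapsto(r+\epsilon,i)$ and fix $\pm\infty$. This is a poset automorphism. For a module $V$, $V(\epsilon)$ is given by $V(\epsilon)_b=V_{\Lambda_\epsilon(b)}$ and $V(\epsilon)(b,b')=V(\Lambda_\epsilon b,\Lambda_\epsilon b')$. The morphism $V_{0\to\epsilon}\colon V\to V(\epsilon)$ has components $V(b,\Lambda_\epsilon(b))$. A module $V$ is $\Lambda_\epsilon$-trivial if $V_{0\to\epsilon}=0$. For $A\subseteq B$: - $A^\uparrow=\{p:\exists a\in A,\ a\le p\}$ and $A^\downarrow=\{p:\exists a\in A,\ p\le a\}$; - $\mathrm{Ex}_\epsilon(A)=\Lambda_\epsilon^{-1}(A)^\uparrow\cap\Lambda_\epsilon(A)^\downarrow$,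 where $\Lambda_\epsilon^{-1}(A)$ is the preimage. A $\Lambda_\epsilon$-matching between multisets $\mathscr{A},\mathscr{C}$ of intervals is a bijection $\sigma\colon\mathscr{A}'\to\mathscr{C}'$ between submultisets such that: - every $I\in\mathscr{A}\setminus\mathscr{A}'$ and every $J\in\mathscr{C}\setminus\mathscr{C}'$ has $k_I$ (resp. $k_J$) $\Lambda_{2\epsilon}$-trivial; - $\sigma(I)=J$ implies $I\subseteq\mathrm{Ex}_\epsilon(J)$ and $J\subseteq\mathrm{Ex}_\epsilon(I)$. $d_{\mathrm{B}}^{\Lambda}(\mathscr{A},\mathscr{C})$ is the infimum of $\epsilon\ge0$ for which a $\Lambda_\epsilon$-matching exists, with $\inf\emptyset=+\infty$. *)

theory Defs
  imports "HOL-Analysis.Analysis" "HOL-Homology.Homology" "HOL-Library.Function_Algebras"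
begin

datatype bidx = One | Two

datatype bpt = MInf | PInf | Pt real bidx

definition ble :: "bpt \<Rightarrow> bpt \<Rightarrow> bool" where
  "ble x y \<longleftrightarrow> x = MInf \<or> y = PInf \<or>
     (\<exists>s t i. x = Pt s i \<and> y = Pt t i \<and> s \<le> t)"

definition bconvex :: "bpt set \<Rightarrow> bool" where
  "bconvex I \<longleftrightarrow> (\<forall>p\<in>I. \<forall>q\<in>I. \<forall>r. ble p r \<and> ble r q \<longrightarrow> r \<in> I)"

definition bconnected :: "bpt set \<Rightarrow> bool" where
  "bconnected I \<longleftrightarrow> (\<forall>p\<in>I. \<forall>q\<in>I. \<exists>xs. xs \<noteq> [] \<and> hd xs = p \<and> last xs = q \<and>
      set xs \<subseteq> I \<and> (\<forall>i < length xs - 1. ble (xs!i) (xs!Suc i) \<or> ble (xs!Suc i) (xs!i)))"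

definition binterval :: "bpt set \<Rightarrow> bool" where
  "binterval I \<longleftrightarrow> I \<noteq> {} \<and> bconvex I \<and> bconnected I"

fun shift :: "real \<Rightarrow> bpt \<Rightarrow> bpt" where
  "shift e (Pt r i) = Pt (r + e) i"
| "shift e MInf = MInf"
| "shift e PInf = PInf"

definition upset :: "bpt set \<Rightarrow> bpt set" where
  "upset A = {p. \<exists>a\<in>A. ble a p}"

definition downset :: "bpt set \<Rightarrow> bpt set" where
  "downset A = {p. \<exists>a\<in>A. ble p a}"

definition Ex :: "real \<Rightarrow> bpt set \<Rightarrow> bpt set" where
  "Ex e A = upset (shift e -` A) \<inter> downset (shift e ` A)"

definition intmod_space :: "bpt set \<Rightarrow> bpt \<Rightarrow> 'k::field set" where
  "intmod_space I b = (if b \<in> I then UNIV else {0})"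

definition intmod_map :: "bpt set \<Rightarrow> bpt \<Rightarrow> bpt \<Rightarrow> 'k::field \<Rightarrow> 'k" where
  "intmod_map I b b' x = (if b \<in> I \<and> b' \<in> I then x else 0)"

definition intmod_trivial :: "'k::field itself \<Rightarrow> real \<Rightarrow> bpt set \<Rightarrow> bool" where
  "intmod_trivial TYPE('k) e I \<longleftrightarrow>
     (\<forall>b. \<forall>x \<in> (intmod_space I b :: 'k set). intmod_map I b (shift e b) x = 0)"

text \<open>A multiset of intervals is a multiplicity function m; its elements are the pairs (I,j), j < m I.\<close>
definition melems :: "(bpt set \<Rightarrow> nat) \<Rightarrow> (bpt set \<times> nat) set" where
  "melems m = {(I, j). j < m I}"

definition lam_matching :: "'k::field itself \<Rightarrow> real \<Rightarrow> (bpt set \<Rightarrow> nat) \<Rightarrow> (bpt set \<Rightarrow> nat) \<Rightarrow> bool" where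
  "lam_matching TYPE('k) e mA mC \<longleftrightarrow>
    (\<exists>A' C' \<sigma>. A' \<subseteq> melems mA \<and> C' \<subseteq> melems mC \<and> bij_betw \<sigma> A' C' \<and>
       (\<forall>p \<in> melems mA - A'. intmod_trivial TYPE('k) (2 * e) (fst p)) \<and>
       (\<forall>p \<in> melems mC - C'. intmod_trivial TYPE('k) (2 * e) (fst p)) \<and>
       (\<forall>p \<in> A'. fst p \<subseteq> Ex e (fst (\<sigma> p)) \<and> fst (\<sigma> p) \<subseteq> Ex e (fst p)))"

definition dB :: "'k::field itself \<Rightarrow> (bpt set \<Rightarrow> nat) \<Rightarrow> (bpt set \<Rightarrow> nat) \<Rightarrow> ennreal" where
  "dB TYPE('k) mA mC = Inf {ennreal e | e. e \<ge> 0 \<and> lam_matching TYPE('k) e mA mC}"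

text \<open>The direct sum of interval modules with multiplicities m: at b, finitely supported
  families indexed by the pairs (I,j) with b in I, j < m I.\<close>
definition dsum_space :: "(bpt set \<Rightarrow> nat) \<Rightarrow> bpt \<Rightarrow> (bpt set \<times> nat \<Rightarrow> 'k::field) set" where
  "dsum_space m b = {x. finite {p. x p \<noteq> 0} \<and> (\<forall>I j. x (I, j) \<noteq> 0 \<longrightarrow> b \<in> I \<and> j < m I)}"

definition dsum_map :: "bpt \<Rightarrow> bpt \<Rightarrow> (bpt set \<times> nat \<Rightarrow> 'k::field) \<Rightarrow> (bpt set \<times> nat \<Rightarrow> 'k)" where
  "dsum_map b b' x = (\<lambda>(I, j). intmod_map I b b' (x (I, j)))"

definition is_barcode ::
  "(bpt \<Rightarrow> 'v set) \<Rightarrow> (bpt \<Rightarrow> 'v \<Rightarrow> 'v \<Rightarrow> 'v) \<Rightarrow> (bpt \<Rightarrow> 'k::field \<Rightarrow> 'v \<Rightarrow> 'v)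
    \<Rightarrow> (bpt \<Rightarrow> bpt \<Rightarrow> 'v \<Rightarrow> 'v) \<Rightarrow> (bpt set \<Rightarrow> nat) \<Rightarrow> bool" where
  "is_barcode V vadd vsm mp m \<longleftrightarrow>
     (\<forall>I. m I > 0 \<longrightarrow> binterval I) \<and>
     (\<exists>\<phi> :: bpt \<Rightarrow> 'v \<Rightarrow> (bpt set \<times> nat \<Rightarrow> 'k).
        (\<forall>b. bij_betw (\<phi> b) (V b) (dsum_space m b)) \<and>
        (\<forall>b. \<forall>x\<in>V b. \<forall>y\<in>V b. \<phi> b (vadd b x y) = \<phi> b x + \<phi> b y) \<and>
        (\<forall>b. \<forall>r. \<forall>x\<in>V b. \<phi> b (vsm b r x) = (\<lambda>p. r * \<phi> b x p)) \<and>
        (\<forall>b b'. ble b b' \<longrightarrow> (\<forall>x\<in>V b. \<phi> b' (mp b b' x) = dsum_map b b' (\<phi> b x))))"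

type_synonym ('a, 'k) kchain = "((nat \<Rightarrow> real) \<Rightarrow> 'a) \<Rightarrow> 'k"

definition kchains :: "nat \<Rightarrow> 'a topology \<Rightarrow> ('a, 'k::field) kchain set" where
  "kchains p X = {c. finite {\<sigma>. c \<sigma> \<noteq> 0} \<and> (\<forall>\<sigma>. c \<sigma> \<noteq> 0 \<longrightarrow> singular_simplex p X \<sigma>)}"

definition kboundary :: "nat \<Rightarrow> ('a, 'k::field) kchain \<Rightarrow> ('a, 'k) kchain" where
  "kboundary p c = (if p = 0 then (\<lambda>_. 0) else
     (\<lambda>\<tau>. \<Sum>\<sigma>\<in>{\<sigma>. c \<sigma> \<noteq> 0}. \<Sum>i\<le>p. if singular_face p i \<sigma> = \<tau> then (-1) ^ i * c \<sigma> else 0))"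

definition kcycles :: "nat \<Rightarrow> 'a topology \<Rightarrow> ('a, 'k::field) kchain set" where
  "kcycles p X = {c \<in> kchains p X. kboundary p c = (\<lambda>_. 0)}"

definition kbounds :: "nat \<Rightarrow> 'a topology \<Rightarrow> ('a, 'k::field) kchain set" where
  "kbounds p X = kboundary (Suc p) ` kchains (Suc p) X"

definition khom :: "nat \<Rightarrow> 'a topology \<Rightarrow> ('a, 'k::field) kchain set set" where
  "khom q X = (\<lambda>z. (+) z ` kbounds q X) ` kcycles q X"

definition khom_add :: "('a, 'k::field) kchain set \<Rightarrow> ('a, 'k) kchain set \<Rightarrow> ('a, 'k) kchain set" where
  "khom_add A A' = {a + a' | a a'. a \<in> A \<and> a' \<in> A'}"

definition khom_smult :: "nat \<Rightarrow> 'a topology \<Rightarrow> 'k::field \<Rightarrow> ('a, 'k) kchain set \<Rightarrow> ('a, 'k) kchain set" where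
  "khom_smult q X r A = {(\<lambda>\<sigma>. r * a \<sigma>) + z | a z. a \<in> A \<and> z \<in> kbounds q X}"

text \<open>map induced by an inclusion X into Y: [z] |-> [z]\<close>
definition khom_incl :: "nat \<Rightarrow> 'a topology \<Rightarrow> ('a, 'k::field) kchain set \<Rightarrow> ('a, 'k) kchain set" where
  "khom_incl q Y A = khom_add A (kbounds q Y)"

definition khom_findim :: "nat \<Rightarrow> 'a topology \<Rightarrow> 'k::field itself \<Rightarrow> bool" where
  "khom_findim q X TYPE('k) \<longleftrightarrow>
     (\<exists>F \<subseteq> (kcycles q X :: ('a,'k) kchain set). finite F \<and>
        (\<forall>z \<in> kcycles q X. \<exists>c. z - (\<Sum>s\<in>F. (\<lambda>\<sigma>. c s * s \<sigma>)) \<in> kbounds q X))"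

definition bipath_function :: "'a topology \<Rightarrow> ('a \<Rightarrow> bpt) \<Rightarrow> ('a \<Rightarrow> bpt) \<Rightarrow> bool" where
  "bipath_function X f1 f2 \<longleftrightarrow>
     (\<forall>x\<in>topspace X. \<forall>r. f1 x \<noteq> Pt r Two \<and> f2 x \<noteq> Pt r One) \<and>
     {x\<in>topspace X. f1 x = MInf} = {x\<in>topspace X. f2 x = MInf}"

definition sublevel :: "'a topology \<Rightarrow> ('a \<Rightarrow> bpt) \<Rightarrow> ('a \<Rightarrow> bpt) \<Rightarrow> bpt \<Rightarrow> 'a set" where
  "sublevel X f1 f2 b = (case b of
      MInf \<Rightarrow> {x\<in>topspace X. f1 x = MInf}
    | PInf \<Rightarrow> topspace X
    | Pt r One \<Rightarrow> {x\<in>topspace X. ble (f1 x) (Pt r One)}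
    | Pt r Two \<Rightarrow> {x\<in>topspace X. ble (f2 x) (Pt r Two)})"

definition Vf_space :: "nat \<Rightarrow> 'a topology \<Rightarrow> ('a \<Rightarrow> bpt) \<Rightarrow> ('a \<Rightarrow> bpt) \<Rightarrow> bpt \<Rightarrow> ('a, 'k::field) kchain set set" where
  "Vf_space q X f1 f2 b = khom q (subtopology X (sublevel X f1 f2 b))"

definition Vf_add :: "bpt \<Rightarrow> ('a, 'k::field) kchain set \<Rightarrow> ('a, 'k) kchain set \<Rightarrow> ('a, 'k) kchain set" where
  "Vf_add b = khom_add"

definition Vf_smult :: "nat \<Rightarrow> 'a topology \<Rightarrow> ('a \<Rightarrow> bpt) \<Rightarrow> ('a \<Rightarrow> bpt) \<Rightarrow> bpt \<Rightarrow> 'k::field \<Rightarrow> ('a, 'k) kchain set \<Rightarrow> ('a, 'k) kchain set" where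
  "Vf_smult q X f1 f2 b = khom_smult q (subtopology X (sublevel X f1 f2 b))"

definition Vf_map :: "nat \<Rightarrow> 'a topology \<Rightarrow> ('a \<Rightarrow> bpt) \<Rightarrow> ('a \<Rightarrow> bpt) \<Rightarrow> bpt \<Rightarrow> bpt \<Rightarrow> ('a, 'k::field) kchain set \<Rightarrow> ('a, 'k) kchain set" where
  "Vf_map q X f1 f2 b b' = khom_incl q (subtopology X (sublevel X f1 f2 b'))"

definition tame :: "'k::field itself \<Rightarrow> nat \<Rightarrow> 'a topology \<Rightarrow> ('a \<Rightarrow> bpt) \<Rightarrow> ('a \<Rightarrow> bpt) \<Rightarrow> bool" where
  "tame TYPE('k) q X f1 f2 \<longleftrightarrow>
     (\<forall>b. khom_findim q (subtopology X (sublevel X f1 f2 b)) TYPE('k))"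

definition barcode_of :: "'k::field itself \<Rightarrow> nat \<Rightarrow> 'a topology \<Rightarrow> ('a \<Rightarrow> bpt) \<Rightarrow> ('a \<Rightarrow> bpt) \<Rightarrow> (bpt set \<Rightarrow> nat) \<Rightarrow> bool" where
  "barcode_of TYPE('k) q X f1 f2 m \<longleftrightarrow>
     is_barcode (Vf_space q X f1 f2 :: bpt \<Rightarrow> ('a,'k) kchain set set)
       Vf_add (Vf_smult q X f1 f2) (Vf_map q X f1 f2) m"

fun bdist :: "bpt \<Rightarrow> bpt \<Rightarrow> ennreal" where
  "bdist (Pt r i) (Pt s j) = (if i = j then ennreal \<bar>r - s\<bar> else (Orderings.top::ennreal))"
| "bdist x y = (if x = y then 0 else (Orderings.top::ennreal))"

definition fdist :: "'a topology \<Rightarrow> ('a \<Rightarrow> bpt) \<Rightarrow> ('a \<Rightarrow> bpt) \<Rightarrow> ('a \<Rightarrow> bpt) \<Rightarrow> ('a \<Rightarrow> bpt) \<Rightarrow> ennreal" where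
  "fdist X f1 f2 g1 g2 = max (SUP x\<in>topspace X. bdist (f1 x) (g1 x)) (SUP x\<in>topspace X. bdist (f2 x) (g2 x))"

end

theory Submission
  imports Defs
begin

text \<open>If \<open>\<parallel>f, g\<parallel> = e\<close> is finite, the sublevel sets of \<open>f\<close> and \<open>g\<close> are nested up to a shift by \<open>e\<close>, so
  the inclusions interleave the two persistence modules. Expressed in bases adapted to the barcodes,
  the interleaving is a pair of matrices whose nonzero entries force inequalities between the
  endpoints of intervals. Ordering intervals of one type by the sum of their two endpoint coordinates,
  a product of entries passing from \<open>I\<close> through \<open>J\<close> to an \<open>I'\<close> not below \<open>I\<close> can only be nonzero when
  \<open>J\<close> is \<open>e\<close>-close to \<open>I\<close> or \<open>I'\<close>. Hence, for a finite set \<open>S\<close> of intervals that survive a shift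
  by \<open>2 e\<close>, a unitriangular \<open>S \<times> S\<close> matrix factors through the neighbours of \<open>S\<close>; this is Hall's
  condition (the argument is due to Bjerkevik). Matchings obtained from both sides are combined as in
  the Schroeder-Bernstein theorem. Since the bottleneck distance is an infimum, it is enough to find
  matchings for all \<open>e' > e\<close>, and so the open or closed character of endpoints plays no role.\<close>

section \<open>Matchings and ranks\<close>

text \<open>Rado's argument: in an edge-minimal bipartite graph satisfying Hall's condition every vertex on
  the left has degree one, since deleting either of two edges at \<open>p\<close> produces a violating set, and
  submodularity of the neighbourhood size makes the two violations contradict each other. Finite
  degrees are what lets Zorn's lemma find a minimal graph.\<close>
lemma rado_selection_finite_degree:
  fixes N :: "'p \<Rightarrow> 'q set"
  assumes fin: "\<And>p. p \<in> P \<Longrightarrow> finite (N p)"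
    and hall: "\<And>S. S \<subseteq> P \<Longrightarrow> finite S \<Longrightarrow> card S \<le> card (\<Union>p\<in>S. N p)"
  shows "\<exists>\<sigma>. inj_on \<sigma> P \<and> (\<forall>p\<in>P. \<sigma> p \<in> N p)"
proof -
  define E where "E = Sigma P N"
  define H where "H R \<longleftrightarrow> (\<forall>S. S \<subseteq> P \<longrightarrow> finite S \<longrightarrow> card S \<le> card (R `` S))" for R :: "('p \<times> 'q) set"
  have finE: "finite (E \<inter> S \<times> UNIV)" if "finite S" for S
  proof (rule finite_subset)
    show "E \<inter> S \<times> UNIV \<subseteq> Sigma (S \<inter> P) N" by (auto simp: E_def)
    show "finite (Sigma (S \<inter> P) N)" using that fin by (intro finite_SigmaI) auto
  qed
  have finR: "finite (R `` S)" if "finite S" "R \<subseteq> E" for S R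
  proof (rule finite_subset)
    show "R `` S \<subseteq> snd ` (E \<inter> S \<times> UNIV)" using that(2) by force
    show "finite (snd ` (E \<inter> S \<times> UNIV))" using finE[OF that(1)] by simp
  qed
  have HE: "H E"
  proof -
    have "E `` S = (\<Union>p\<in>S. N p)" if "S \<subseteq> P" for S
      using that by (auto simp: E_def)
    then show ?thesis using hall by (simp add: H_def)
  qed
  \<comment> \<open>Ordering the sets of deleted edges, rather than the remaining graphs, by
    inclusion turns a minimal graph into a maximal element.\<close>
  define \<A> where "\<A> = {D. D \<subseteq> E \<and> H (E - D)}"
  have "\<exists>M\<in>\<A>. \<forall>X\<in>\<A>. M \<subseteq> X \<longrightarrow> X = M"
  proof (rule subset_Zorn')
    fix C assume C: "subset.chain \<A> C"
    show "\<Union>C \<in> \<A>"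
    proof (cases "C = {}")
      case True
      then show ?thesis using HE by (simp add: \<A>_def)
    next
      case False
      have sub: "\<Union>C \<subseteq> E" using C by (auto simp: subset.chain_def \<A>_def)
      have "H (E - \<Union>C)"
        unfolding H_def
      proof (intro allI impI)
        fix S assume S: "S \<subseteq> P" "finite S"
        \<comment> \<open>Only finitely many edges start in \<open>S\<close>, so a single member of
          the chain already contains every deletion there, and Hall's inequality at \<open>S\<close>
          is inherited from it.\<close>
        have f: "finite (\<Union>C \<inter> S \<times> UNIV)"
          by (rule finite_subset[OF _ finE[OF S(2)]]) (use sub in blast)
        obtain D where D: "D \<in> C" "\<Union>C \<inter> S \<times> UNIV \<subseteq> D"
          using finite_subset_Union_chain[OF f _ False C] by blast
        have "(E - \<Union>C) `` S = (E - D) `` S" using D by blast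
        moreover have "H (E - D)" using D(1) C by (auto simp: subset.chain_def \<A>_def)
        ultimately show "card S \<le> card ((E - \<Union>C) `` S)" using S by (simp add: H_def)
      qed
      then show ?thesis using sub by (simp add: \<A>_def)
    qed
  qed
  then obtain D where D: "D \<in> \<A>" "\<And>X. X \<in> \<A> \<Longrightarrow> D \<subseteq> X \<Longrightarrow> X = D" by blast
  define R where "R = E - D"
  have RE: "R \<subseteq> E" by (auto simp: R_def)
  have HR: "H R" using D(1) by (simp add: \<A>_def R_def)
  have crit: "\<exists>S. S \<subseteq> P \<and> finite S \<and> p \<in> S \<and> card ((R - {(p,q)}) `` S) < card S"
    if pq: "(p,q) \<in> R" for p q
  proof -
    have "insert (p,q) D \<notin> \<A>" using D(2)[of "insert (p,q) D"] pq by (auto simp: R_def)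
    moreover have "insert (p,q) D \<subseteq> E" using pq D(1) by (auto simp: R_def \<A>_def)
    ultimately have "\<not> H (E - insert (p,q) D)" by (simp add: \<A>_def)
    moreover have "E - insert (p,q) D = R - {(p,q)}" by (auto simp: R_def)
    ultimately obtain S where S: "S \<subseteq> P" "finite S" "card ((R - {(p,q)}) `` S) < card S"
      by (auto simp: H_def not_le)
    have "p \<in> S"
    proof (rule ccontr)
      assume "p \<notin> S"
      then have "(R - {(p,q)}) `` S = R `` S" by blast
      then show False using S HR by (auto simp: H_def not_le[symmetric])
    qed
    then show ?thesis using S by blast
  qed
  have uniq: "q1 = q2" if q: "(p,q1) \<in> R" "(p,q2) \<in> R" for p q1 q2
  proof (rule ccontr)
    assume ne: "q1 \<noteq> q2"
    obtain S1 where S1: "S1 \<subseteq> P" "finite S1" "p \<in> S1" "card ((R - {(p,q1)}) `` S1) < card S1"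
      using crit[OF q(1)] by blast
    obtain S2 where S2: "S2 \<subseteq> P" "finite S2" "p \<in> S2" "card ((R - {(p,q2)}) `` S2) < card S2"
      using crit[OF q(2)] by blast
    define X1 where "X1 = (R - {(p,q1)}) `` S1"
    define X2 where "X2 = (R - {(p,q2)}) `` S2"
    have fX: "finite X1" "finite X2"
      unfolding X1_def X2_def using S1 S2 RE by (auto intro!: finR)
    have "card (S1 \<union> S2) \<le> card (R `` (S1 \<union> S2))"
      using HR S1 S2 by (simp add: H_def)
    \<comment> \<open>Each of the two deleted edges survives in the other reduced graph, and
      \<open>p\<close> lies in both sets, so no neighbour of the union is lost.\<close>
    also have "\<dots> \<le> card (X1 \<union> X2)"
      by (rule card_mono) (use fX ne q S1(3) S2(3) in \<open>auto simp: X1_def X2_def\<close>)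
    finally have a: "card (S1 \<union> S2) \<le> card (X1 \<union> X2)" .
    \<comment> \<open>Both deleted edges start at \<open>p\<close>, so the other vertices keep all
      their edges in both graphs. Leaving out \<open>p\<close> costs 1, while the two violations
      together gain 2.\<close>
    have "S1 \<inter> S2 - {p} \<subseteq> P" "finite (S1 \<inter> S2 - {p})" using S1(1,2) by auto
    then have "card (S1 \<inter> S2 - {p}) \<le> card (R `` (S1 \<inter> S2 - {p}))"
      using HR by (simp add: H_def)
    also have "\<dots> \<le> card (X1 \<inter> X2)"
      by (rule card_mono) (use fX in \<open>auto simp: X1_def X2_def\<close>)
    finally have b: "card (S1 \<inter> S2) \<le> card (X1 \<inter> X2) + 1"
      using S1 S2 by simp
    show False
      using a b card_Un_Int[OF fX] card_Un_Int[OF S1(2) S2(2)] S1(4) S2(4)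
      unfolding X1_def[symmetric] X2_def[symmetric] by linarith
  qed
  have ex: "\<exists>q. (p,q) \<in> R" if "p \<in> P" for p
  proof -
    have "card {p} \<le> card (R `` {p})" using HR that unfolding H_def by blast
    then have "R `` {p} \<noteq> {}" by force
    then show ?thesis by blast
  qed
  define \<sigma> where "\<sigma> p = (SOME q. (p,q) \<in> R)" for p
  have \<sigma>: "(p, \<sigma> p) \<in> R" if "p \<in> P" for p
    unfolding \<sigma>_def using someI_ex[OF ex[OF that]] .
  have "inj_on \<sigma> P"
  proof (rule inj_onI, rule ccontr)
    fix p p' assume p: "p \<in> P" "p' \<in> P" "\<sigma> p = \<sigma> p'" "p \<noteq> p'"
    have "card {p,p'} \<le> card (R `` {p,p'})"
      using HR p(1,2) by (simp add: H_def)
    also have "\<dots> \<le> card {\<sigma> p}"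
    proof (rule card_mono)
      show "R `` {p,p'} \<subseteq> {\<sigma> p}"
        using uniq[OF \<sigma>[OF p(1)]] uniq[OF \<sigma>[OF p(2)]] p(3) by auto
    qed simp
    finally show False using p(4) by simp
  qed
  moreover have "\<sigma> p \<in> N p" if "p \<in> P" for p
    using \<sigma>[OF that] RE by (auto simp: E_def)
  ultimately show ?thesis by blast
qed

text \<open>On the orbits of \<open>g \<circ> f\<close> that start outside the range of \<open>g\<close> one has to use \<open>f\<close>; everywhere
  else \<open>g\<close> works.\<close>
lemma mendelsohn_dulmage:
  assumes f: "inj_on f P0" "\<And>p. p \<in> P0 \<Longrightarrow> f p \<in> Q \<and> R p (f p)"
    and g: "inj_on g Q0" "\<And>q. q \<in> Q0 \<Longrightarrow> g q \<in> P \<and> R (g q) q"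
    and "P0 \<subseteq> P" "Q0 \<subseteq> Q"
  shows "\<exists>A C \<sigma>. P0 \<subseteq> A \<and> A \<subseteq> P \<and> Q0 \<subseteq> C \<and> C \<subseteq> Q \<and> bij_betw \<sigma> A C \<and> (\<forall>p\<in>A. R p (\<sigma> p))"
proof -
  define X where "X = lfp (\<lambda>X. (P0 - g ` Q0) \<union> {g (f x) |x. x \<in> X \<and> f x \<in> Q0 \<and> g (f x) \<in> P0})"
  have X: "X = (P0 - g ` Q0) \<union> {g (f x) |x. x \<in> X \<and> f x \<in> Q0 \<and> g (f x) \<in> P0}"
    unfolding X_def by (rule lfp_unfold) (auto simp: mono_def)
  have Xcases: "(x \<in> P0 \<and> x \<notin> g ` Q0) \<or> (\<exists>x'\<in>X. f x' \<in> Q0 \<and> x = g (f x') \<and> x \<in> P0)"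
    if "x \<in> X" for x
    using that by (subst (asm) X) auto
  have Xstep: "g (f x) \<in> X" if "x \<in> X" "f x \<in> Q0" "g (f x) \<in> P0" for x
    using that by (subst X) auto
  have Xbase: "x \<in> X" if "x \<in> P0" "x \<notin> g ` Q0" for x
    using that by (subst X) auto
  have XP: "X \<subseteq> P0" using Xcases by blast
  \<comment> \<open>Elements of \<open>Q0\<close> missed by \<open>f\<close> on \<open>X\<close>
    keep their \<open>g\<close>-partner. Since \<open>X\<close> is closed under \<open>g\<close>
    after \<open>f\<close>, these partners lie outside \<open>X\<close>, and the two partial
    bijections can be glued.\<close>
  define Y where "Y = Q0 - f ` X"
  define \<sigma> where "\<sigma> p = (if p \<in> X then f p else inv_into Q0 g p)" for p
  have gY: "g y \<notin> X" if y: "y \<in> Y" for y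
  proof
    assume "g y \<in> X"
    then obtain x where x: "g y = g (f x)" "x \<in> X" "f x \<in> Q0"
      using Xcases[of "g y"] y unfolding Y_def by blast
    then have "y = f x" using g(1) y by (auto simp: Y_def dest: inj_onD)
    then show False using x y by (auto simp: Y_def)
  qed
  have \<sigma>g: "\<sigma> (g y) = y" if "y \<in> Y" for y
    using that gY[OF that] g(1) by (auto simp: \<sigma>_def Y_def)
  have b1: "bij_betw \<sigma> X (f ` X)"
    by (rule bij_betw_imageI) (use inj_on_subset[OF f(1) XP] in \<open>auto simp: \<sigma>_def inj_on_def\<close>)
  have b2: "bij_betw \<sigma> (g ` Y) Y"
    by (rule bij_betw_byWitness[where f'=g]) (use \<sigma>g in auto)
  have b: "bij_betw \<sigma> (X \<union> g ` Y) (f ` X \<union> Y)"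
    by (rule bij_betw_combine[OF b1 b2]) (auto simp: Y_def)
  have c1: "P0 \<subseteq> X \<union> g ` Y"
  proof
    fix p assume p: "p \<in> P0"
    show "p \<in> X \<union> g ` Y"
    proof (cases "p \<in> X")
      case False
      then obtain y where y: "y \<in> Q0" "p = g y" using Xbase[OF p] by blast
      have "y \<notin> f ` X"
      proof
        assume "y \<in> f ` X"
        then have "g y \<in> X" using Xstep y p by auto
        then show False using False y by simp
      qed
      then show ?thesis using y by (auto simp: Y_def)
    qed simp
  qed
  have c2: "\<forall>p \<in> X \<union> g ` Y. R p (\<sigma> p)"
  proof
    fix p assume "p \<in> X \<union> g ` Y"
    then show "R p (\<sigma> p)"
    proof
      assume "p \<in> X"
      then show ?thesis using f(2) XP by (auto simp: \<sigma>_def)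
    next
      assume "p \<in> g ` Y"
      then show ?thesis using \<sigma>g g(2) by (auto simp: Y_def)
    qed
  qed
  show ?thesis
    using b c1 c2 XP f(2) g(2) assms(5,6)
    by (intro exI[of _ "X \<union> g ` Y"] exI[of _ "f ` X \<union> Y"] exI[of _ \<sigma>]) (auto simp: Y_def)
qed

section \<open>Linear algebra: a rank bound from unitriangular factorizations\<close>

lemma underdetermined_homogeneous_system:
  fixes A :: "'q \<Rightarrow> 'p \<Rightarrow> 'k::field"
  assumes "finite T" "finite S" "card T < card S"
  shows "\<exists>x. (\<exists>p\<in>S. x p \<noteq> 0) \<and> (\<forall>q\<in>T. (\<Sum>p\<in>S. A q p * x p) = 0)"
  using assms
proof (induction T arbitrary: S A rule: finite_induct)
  case empty
  then obtain p where "p \<in> S" by fastforce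
  then show ?case by (intro exI[of _ "\<lambda>_. 1"]) auto
next
  case (insert q T)
  show ?case
  proof (cases "\<forall>p\<in>S. A q p = 0")
    case True
    obtain x where "\<exists>p\<in>S. x p \<noteq> 0" "\<forall>q\<in>T. (\<Sum>p\<in>S. A q p * x p) = 0"
      using insert.IH[of S A] insert.prems insert.hyps by auto
    then show ?thesis using True by (intro exI[of _ x]) auto
  next
    case False
    \<comment> \<open>Gaussian elimination: \<open>p0\<close> is the pivot of equation
      \<open>q\<close>. Substituting for its unknown lowers both the number of equations and the
      number of unknowns by one; \<open>y\<close> below restores the value that equation
      \<open>q\<close> dictates.\<close>
    then obtain p0 where p0: "p0 \<in> S" "A q p0 \<noteq> 0" by blast
    define S' where "S' = S - {p0}"
    have S: "S = insert p0 S'" "p0 \<notin> S'" "finite S'" using p0 insert.prems by (auto simp: S'_def)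
    have "card T < card S'" using insert.prems insert.hyps p0 by (simp add: S'_def)
    from insert.IH[OF S(3) this, of "\<lambda>q' p. A q' p - A q' p0 * A q p / A q p0"]
    obtain x where x: "\<exists>p\<in>S'. x p \<noteq> 0"
      "\<forall>q'\<in>T. (\<Sum>p\<in>S'. (A q' p - A q' p0 * A q p / A q p0) * x p) = 0" by blast
    define s where "s = (\<Sum>p\<in>S'. A q p * x p)"
    define y where "y = x(p0 := - s / A q p0)"
    have sy: "(\<Sum>p\<in>S. A q' p * y p) = (\<Sum>p\<in>S'. A q' p * x p) - A q' p0 * s / A q p0" for q'
    proof -
      have "(\<Sum>p\<in>S'. A q' p * y p) = (\<Sum>p\<in>S'. A q' p * x p)"
        using S(2) by (intro sum.cong) (auto simp: y_def)
      then show ?thesis using S by (simp add: y_def)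
    qed
    have "(\<Sum>p\<in>S. A q' p * y p) = 0" if "q' \<in> insert q T" for q'
    proof (cases "q' = q")
      case True
      then show ?thesis using sy[of q] p0 by (simp add: s_def)
    next
      case False
      then have "0 = (\<Sum>p\<in>S'. (A q' p - A q' p0 * A q p / A q p0) * x p)" using x that by auto
      also have "\<dots> = (\<Sum>p\<in>S'. A q' p * x p) - (\<Sum>p\<in>S'. A q' p0 / A q p0 * (A q p * x p))"
        by (simp add: sum_subtractf[symmetric] algebra_simps)
      also have "\<dots> = (\<Sum>p\<in>S'. A q' p * x p) - A q' p0 * s / A q p0"
        by (simp add: s_def sum_distrib_left sum_divide_distrib)
      finally show ?thesis using sy by simp
    qed
    moreover have "\<exists>p\<in>S. y p \<noteq> 0" using x(1) S by (auto simp: y_def)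
    ultimately show ?thesis by blast
  qed
qed

text \<open>If \<open>T\<close> were smaller, \<open>A\<close> would kill a nonzero vector
  \<open>x\<close>. In the row of \<open>B\<close> times \<open>A\<close> at a support element of
  largest weight, triangularity leaves only the diagonal term, which is a nonzero entry of
  \<open>x\<close>. Distinct indices of equal weight also have zero entries, so ties do no
  harm.\<close>

lemma card_le_unitriangular_factorization:
  fixes A :: "'q \<Rightarrow> 'p \<Rightarrow> 'k::field" and B :: "'p \<Rightarrow> 'q \<Rightarrow> 'k" and \<alpha> :: "'p \<Rightarrow> real"
  assumes fin: "finite S" "finite T"
    and diag: "\<And>p. p \<in> S \<Longrightarrow> (\<Sum>q\<in>T. B p q * A q p) = 1"
    and tri: "\<And>p p'. p \<in> S \<Longrightarrow> p' \<in> S \<Longrightarrow> p \<noteq> p' \<Longrightarrow> \<alpha> p \<le> \<alpha> p' \<Longrightarrow> (\<Sum>q\<in>T. B p' q * A q p) = 0"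
  shows "card S \<le> card T"
proof (rule ccontr)
  assume "\<not> card S \<le> card T"
  then obtain x where x: "\<exists>p\<in>S. x p \<noteq> 0" "\<And>q. q \<in> T \<Longrightarrow> (\<Sum>p\<in>S. A q p * x p) = 0"
    using underdetermined_homogeneous_system[OF fin(2,1), of A] by auto
  define U where "U = {p\<in>S. x p \<noteq> 0}"
  have U: "finite U" "U \<noteq> {}" using fin x by (auto simp: U_def)
  obtain p' where p': "p' \<in> U" "\<And>p. p \<in> U \<Longrightarrow> \<alpha> p \<le> \<alpha> p'"
    using Max_in[of "\<alpha> ` U"] Max_ge[of "\<alpha> ` U"] U by (metis (no_types, lifting) finite_imageI image_iff image_is_empty)
  have "0 = (\<Sum>q\<in>T. B p' q * (\<Sum>p\<in>S. A q p * x p))" using x(2) by simp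
  also have "\<dots> = (\<Sum>q\<in>T. \<Sum>p\<in>S. B p' q * A q p * x p)"
    by (simp add: sum_distrib_left mult.assoc)
  also have "\<dots> = (\<Sum>p\<in>S. (\<Sum>q\<in>T. B p' q * A q p) * x p)"
    by (subst sum.swap) (simp add: sum_distrib_right)
  also have "\<dots> = (\<Sum>p\<in>S. if p = p' then x p' else 0)"
  proof (rule sum.cong[OF refl])
    fix p assume p: "p \<in> S"
    show "(\<Sum>q\<in>T. B p' q * A q p) * x p = (if p = p' then x p' else 0)"
      using p p' diag[of p] tri[of p p'] by (cases "x p = 0") (auto simp: U_def)
  qed
  also have "\<dots> = x p'" using p'(1) fin by (simp add: U_def)
  finally show False using p'(1) by (simp add: U_def)
qed

section \<open>Intervals of the bipath poset\<close>

text \<open>The conditions that naturality puts on \<open>I\<close> and \<open>J\<close> when a morphism from the interval module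
  of \<open>I\<close> to the \<open>e\<close>-shift of that of \<open>J\<close> is nonzero at \<open>b\<close>.\<close>
definition bhom :: "real \<Rightarrow> bpt \<Rightarrow> bpt set \<Rightarrow> bpt set \<Rightarrow> bool" where
  "bhom e b I J \<longleftrightarrow> b \<in> I \<and> shift e b \<in> J \<and> (\<forall>x. ble x b \<and> x \<in> I \<longrightarrow> shift e x \<in> J) \<and>
     (\<forall>y. ble b y \<and> shift e y \<in> J \<longrightarrow> y \<in> I)"

definition arm_pts :: "bidx \<Rightarrow> bpt set \<Rightarrow> ereal set" where
  "arm_pts i I = {ereal r |r. Pt r i \<in> I}"

text \<open>Two coordinates that determine an interval up to decoration of its endpoints: the ends of both
  arms if the interval contains exactly one of the two extreme points, and both ends of its single
  arm if it contains none.\<close>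
definition co1 :: "bpt set \<Rightarrow> ereal" where
  "co1 I = (if MInf \<in> I then Sup (arm_pts One I) else if PInf \<in> I then Inf (arm_pts One I)
     else Inf (arm_pts One I \<union> arm_pts Two I))"

definition co2 :: "bpt set \<Rightarrow> ereal" where
  "co2 I = (if MInf \<in> I then Sup (arm_pts Two I) else if PInf \<in> I then Inf (arm_pts Two I)
     else Sup (arm_pts One I \<union> arm_pts Two I))"

text \<open>The occupied arm is recorded only for intervals without extreme points. Otherwise an
  empty arm shows up as an infinite coordinate, through the supremum or infimum of the empty set,
  and is recorded by \<open>infpat\<close>.\<close>

definition bkind :: "bpt set \<Rightarrow> bool \<times> bool \<times> bidx set" where
  "bkind I = (MInf \<in> I, PInf \<in> I, if MInf \<in> I \<or> PInf \<in> I then {} else {i. \<exists>r. Pt r i \<in> I})"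

definition infpat :: "ereal \<Rightarrow> bool \<times> bool" where
  "infpat x = (x = \<infinity>, x = -\<infinity>)"

definition bclass :: "bpt set \<Rightarrow> (bool \<times> bool \<times> bidx set) \<times> (bool \<times> bool) \<times> (bool \<times> bool)" where
  "bclass I = (bkind I, infpat (co1 I), infpat (co2 I))"

definition bclose :: "real \<Rightarrow> bpt set \<Rightarrow> bpt set \<Rightarrow> bool" where
  "bclose e I J \<longleftrightarrow> bclass I = bclass J \<and> co1 I \<le> co1 J + ereal e \<and> co1 J \<le> co1 I + ereal e \<and>
     co2 I \<le> co2 J + ereal e \<and> co2 J \<le> co2 I + ereal e"

text \<open>Infinite coordinates count as 0. Weights are compared only inside one
  \<open>bclass\<close>, where the same coordinates are infinite, so the comparison concerns the
  finite ones.\<close>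

definition bweight :: "bpt set \<Rightarrow> real" where
  "bweight I = real_of_ereal (co1 I) + real_of_ereal (co2 I)"

text \<open>Survival of a shift by \<open>2 * e\<close>, up to endpoints: an interval on one arm of
  length exactly \<open>2 * e\<close> is not wide even if closed, but it is trivial for every shift
  parameter above \<open>e\<close>.\<close>

definition bwide :: "real \<Rightarrow> bpt set \<Rightarrow> bool" where
  "bwide e I \<longleftrightarrow> MInf \<in> I \<or> PInf \<in> I \<or> co1 I + ereal (2 * e) < co2 I"

text \<open>A normalized place to test a morphism. At an extreme point of the interval, the
  conditions of \<open>bhom\<close> reach both arms at once; at a point of one arm they would say
  nothing about most of the other.\<close>

definition bbase :: "bpt set \<Rightarrow> bpt \<Rightarrow> bool" where
  "bbase I b \<longleftrightarrow> (MInf \<in> I \<longrightarrow> b = MInf) \<and> (MInf \<notin> I \<and> PInf \<in> I \<longrightarrow> b = PInf)"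

lemma ble_simps [simp]:
  "ble MInf x" "ble x PInf" "ble x MInf \<longleftrightarrow> x = MInf" "ble PInf x \<longleftrightarrow> x = PInf"
  "ble (Pt s i) (Pt t j) \<longleftrightarrow> i = j \<and> s \<le> t"
  by (auto simp: ble_def)

lemma ble_refl [simp]: "ble x x"
  by (cases x) auto

lemma ble_shift: "ble x y \<Longrightarrow> ble (shift e x) (shift e y)"
  by (cases x; cases y) auto

lemma shift_shift [simp]: "shift d (shift e x) = shift (d + e) x"
  by (cases x) auto

lemma shift_eq_iff [simp]:
  "shift e x = MInf \<longleftrightarrow> x = MInf" "shift e x = PInf \<longleftrightarrow> x = PInf"
  by (cases x; auto)+

lemma bconvexD: "bconvex I \<Longrightarrow> p \<in> I \<Longrightarrow> q \<in> I \<Longrightarrow> ble p r \<Longrightarrow> ble r q \<Longrightarrow> r \<in> I"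
  unfolding bconvex_def by blast

lemma bclose_sym: "bclose e I J \<longleftrightarrow> bclose e J I"
  by (auto simp: bclose_def)

lemma bkind_mem:
  assumes "bkind I = bkind J"
  shows "MInf \<in> I \<longleftrightarrow> MInf \<in> J" "PInf \<in> I \<longleftrightarrow> PInf \<in> J"
  using assms by (auto simp: bkind_def)

text \<open>Comparable points that are not extreme lie on the same arm, so a connecting path that
  avoids the extreme points never changes arms.\<close>

lemma binterval_single_arm:
  assumes I: "binterval I" and n: "MInf \<notin> I" "PInf \<notin> I" and a: "Pt r i \<in> I" and b: "x \<in> I"
  shows "\<exists>s. x = Pt s i"
proof -
  obtain xs where xs: "xs \<noteq> []" "hd xs = Pt r i" "last xs = x" "set xs \<subseteq> I"
    "\<forall>k < length xs - 1. ble (xs!k) (xs!Suc k) \<or> ble (xs!Suc k) (xs!k)"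
    using I a b unfolding binterval_def bconnected_def by blast
  have "k < length xs \<Longrightarrow> \<exists>s. xs ! k = Pt s i" for k
  proof (induction k)
    case 0
    then show ?case using xs(1,2) by (metis hd_conv_nth)
  next
    case (Suc k)
    then obtain s where "xs ! k = Pt s i" by auto
    moreover have "xs ! Suc k \<in> I" using xs(4) Suc.prems by (meson nth_mem subsetD)
    moreover have "ble (xs!k) (xs!Suc k) \<or> ble (xs!Suc k) (xs!k)" using xs(5) Suc.prems by auto
    ultimately show ?case using n by (cases "xs ! Suc k") auto
  qed
  from this[of "length xs - 1"] show ?thesis using xs(1,3) by (simp add: last_conv_nth)
qed

lemma binterval_arm:
  assumes "binterval I" "MInf \<notin> I" "PInf \<notin> I"
  obtains i where "I \<noteq> {}" "\<And>x. x \<in> I \<Longrightarrow> \<exists>r. x = Pt r i" "arm_pts One I \<union> arm_pts Two I = arm_pts i I"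
    "bkind I = (False, False, {i})"
proof -
  obtain x where "x \<in> I" using assms by (auto simp: binterval_def)
  then obtain r i where ri: "Pt r i \<in> I" using assms by (cases x) auto
  have *: "\<exists>r. x = Pt r i" if "x \<in> I" for x
    using binterval_single_arm[OF assms ri that] .
  show ?thesis
  proof (rule that[of i])
    show "I \<noteq> {}" using ri by auto
    show "\<exists>r. x = Pt r i" if "x \<in> I" for x using *[OF that] .
    have "arm_pts j I = {}" if "j \<noteq> i" for j using * that by (auto simp: arm_pts_def)
    then show "arm_pts One I \<union> arm_pts Two I = arm_pts i I" by (cases i) auto
    show "bkind I = (False, False, {i})" using assms ri * by (auto simp: bkind_def)
  qed
qed

lemma binterval_arm_mem:
  assumes "binterval I" "MInf \<notin> I" "PInf \<notin> I" "bkind I = (False, False, {i})"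
    and "co1 I < ereal r" "ereal r < co2 I"
  shows "Pt r i \<in> I"
proof -
  obtain j where j: "arm_pts One I \<union> arm_pts Two I = arm_pts j I" "bkind I = (False, False, {j})"
    using binterval_arm[OF assms(1-3)] by metis
  have [simp]: "j = i" using j(2) assms(4) by auto
  obtain s where s: "Pt s i \<in> I" "s < r"
    using assms(2,3,5) j by (auto simp: co1_def Inf_less_iff arm_pts_def)
  obtain t where t: "Pt t i \<in> I" "r < t"
    using assms(2,3,6) j by (auto simp: co2_def less_Sup_iff arm_pts_def)
  show ?thesis
    using assms(1) bconvexD[of I "Pt s i" "Pt t i" "Pt r i"] s t by (auto simp: binterval_def)
qed

section \<open>How nonzero morphisms move endpoints\<close>

lemma ereal_le_addI: "ereal (y - e) \<le> z \<Longrightarrow> ereal y \<le> z + ereal e"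
  by (cases z) auto

lemma Inf_le_Inf_add:
  assumes "\<And>x. x \<in> A \<Longrightarrow> Inf B \<le> x + ereal e"
  shows "Inf B \<le> Inf A + ereal e"
proof -
  have "Inf B - ereal e \<le> Inf A"
  proof (rule Inf_greatest)
    fix x assume "x \<in> A"
    from assms[OF this] show "Inf B - ereal e \<le> x"
      by (cases x; cases "Inf B") auto
  qed
  then show ?thesis by (cases "Inf A"; cases "Inf B") auto
qed

text \<open>Pushing points of \<open>I\<close> below \<open>b\<close> forward bounds the lower ends;
  pulling points of \<open>J\<close> above the shift of \<open>b\<close> back bounds the upper ends.
  With \<open>b\<close> at an extreme point, one of the two applies to every point of both
  arms.\<close>

lemma bhom_co_le:
  assumes h: "bhom e b I J" and k: "bkind I = bkind J" and b: "bbase I b"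
    and I: "binterval I" and J: "binterval J"
  shows "co1 J \<le> co1 I + ereal e \<and> co2 J \<le> co2 I + ereal e"
proof (cases "MInf \<in> I")
  case True
  have "Sup (arm_pts i J) \<le> Sup (arm_pts i I) + ereal e" for i
  proof (rule Sup_least)
    fix x assume "x \<in> arm_pts i J"
    then obtain y where y: "x = ereal y" "Pt y i \<in> J" by (auto simp: arm_pts_def)
    then have "shift e (Pt (y - e) i) \<in> J" by simp
    then have "Pt (y - e) i \<in> I" using h b True unfolding bhom_def bbase_def by (metis ble_simps(1))
    then have "ereal (y - e) \<le> Sup (arm_pts i I)" by (intro Sup_upper) (auto simp: arm_pts_def)
    then show "x \<le> Sup (arm_pts i I) + ereal e" unfolding y(1) by (rule ereal_le_addI)
  qed
  then show ?thesis using True bkind_mem[OF k] by (simp add: co1_def co2_def)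
next
  case M: False
  show ?thesis
  proof (cases "PInf \<in> I")
    case True
    have "Inf (arm_pts i J) \<le> Inf (arm_pts i I) + ereal e" for i
    proof (rule Inf_le_Inf_add)
      fix x assume "x \<in> arm_pts i I"
      then obtain y where y: "x = ereal y" "Pt y i \<in> I" by (auto simp: arm_pts_def)
      then have "shift e (Pt y i) \<in> J" using h b True M unfolding bhom_def bbase_def
        by (metis ble_simps(2))
      then show "Inf (arm_pts i J) \<le> x + ereal e"
        using y by (intro Inf_lower) (auto simp: arm_pts_def)
    qed
    then show ?thesis using True M bkind_mem[OF k] by (simp add: co1_def co2_def)
  next
    case False
    obtain i where i: "\<And>x. x \<in> I \<Longrightarrow> \<exists>r. x = Pt r i" "arm_pts One I \<union> arm_pts Two I = arm_pts i I"
      "bkind I = (False, False, {i})"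
      using binterval_arm[OF I M False] by metis
    obtain j where j: "\<And>x. x \<in> J \<Longrightarrow> \<exists>r. x = Pt r j" "arm_pts One J \<union> arm_pts Two J = arm_pts j J"
      "bkind J = (False, False, {j})"
      using binterval_arm[OF J] M False bkind_mem[OF k] by metis
    have [simp]: "j = i" using i(3) j(3) k by auto
    obtain s where s: "b = Pt s i" using h i(1)[of b] unfolding bhom_def by blast
    have s': "Pt s i \<in> I" "Pt (s + e) i \<in> J" using h by (auto simp: bhom_def s)
    have "Inf (arm_pts i J) \<le> Inf (arm_pts i I) + ereal e"
    proof (rule Inf_le_Inf_add)
      fix x assume "x \<in> arm_pts i I"
      then obtain y where y: "x = ereal y" "Pt y i \<in> I" by (auto simp: arm_pts_def)
      \<comment> \<open>Points up to the base point are pushed into \<open>J\<close>; for later ones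
        the shifted base point is already a low enough element of \<open>J\<close>. The upper ends
        are treated dually.\<close>
      show "Inf (arm_pts i J) \<le> x + ereal e"
      proof (cases "y \<le> s")
        case True
        then have "shift e (Pt y i) \<in> J" using h y unfolding bhom_def s by (metis ble_simps(5))
        then show ?thesis using y by (intro Inf_lower) (auto simp: arm_pts_def)
      next
        case False
        have "Inf (arm_pts i J) \<le> ereal (s + e)"
          using s' by (intro Inf_lower) (auto simp: arm_pts_def)
        also have "\<dots> \<le> x + ereal e" using False y by simp
        finally show ?thesis .
      qed
    qed
    moreover have "Sup (arm_pts i J) \<le> Sup (arm_pts i I) + ereal e"
    proof (rule Sup_least)
      fix x assume "x \<in> arm_pts i J"
      then obtain y where y: "x = ereal y" "Pt y i \<in> J" by (auto simp: arm_pts_def)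
      have "ereal (y - e) \<le> Sup (arm_pts i I)"
      proof (cases "s \<le> y - e")
        case True
        have "shift e (Pt (y - e) i) \<in> J" using y by simp
        then have "Pt (y - e) i \<in> I" using h True unfolding bhom_def s by (metis ble_simps(5))
        then show ?thesis by (intro Sup_upper) (auto simp: arm_pts_def)
      next
        case False
        then have "ereal (y - e) \<le> ereal s" by simp
        also have "\<dots> \<le> Sup (arm_pts i I)" using s' by (intro Sup_upper) (auto simp: arm_pts_def)
        finally show ?thesis .
      qed
      then show "x \<le> Sup (arm_pts i I) + ereal e" unfolding y(1) by (rule ereal_le_addI)
    qed
    ultimately show ?thesis using M False bkind_mem[OF k] i(2) j(2) by (simp add: co1_def co2_def)
  qed
qed

text \<open>Containing the bottom passes forward from \<open>I\<close> through \<open>J\<close> to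
  \<open>I'\<close>, containing the top passes backward, and the equal kinds of \<open>I\<close> and
  \<open>I'\<close> close both circles. Without extreme points, \<open>b\<close> and its shift fix
  the arm.\<close>

lemma bhom_comp_kind:
  assumes h: "bhom e b I J" "bhom e (shift e b) J I'" and k: "bkind I = bkind I'" and b: "bbase I b"
    and I: "binterval I" and J: "binterval J"
  shows "bkind J = bkind I"
proof -
  have up: "\<And>y. ble b y \<Longrightarrow> shift e y \<in> J \<Longrightarrow> y \<in> I" "\<And>x. ble x b \<Longrightarrow> x \<in> I \<Longrightarrow> shift e x \<in> J"
    and bI: "b \<in> I" "shift e b \<in> J"
    using h(1) unfolding bhom_def by blast+
  have dn: "\<And>y. ble (shift e b) y \<Longrightarrow> shift e y \<in> I' \<Longrightarrow> y \<in> J"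
    "\<And>x. ble x (shift e b) \<Longrightarrow> x \<in> J \<Longrightarrow> shift e x \<in> I'"
    using h(2) unfolding bhom_def by blast+
  note m = bkind_mem[OF k]
  have M: "MInf \<in> J \<longleftrightarrow> MInf \<in> I"
    using up(2)[of MInf] dn(2)[of MInf] m by auto
  have P: "PInf \<in> J \<longleftrightarrow> PInf \<in> I"
    using up(1)[of PInf] dn(1)[of PInf] m by auto
  show ?thesis
  proof (cases "MInf \<in> I \<or> PInf \<in> I")
    case True
    then show ?thesis using M P by (auto simp: bkind_def)
  next
    case False
    obtain i where i: "\<And>x. x \<in> I \<Longrightarrow> \<exists>r. x = Pt r i" "bkind I = (False, False, {i})"
      using binterval_arm[OF I] False by metis
    obtain j where j: "\<And>x. x \<in> J \<Longrightarrow> \<exists>r. x = Pt r j" "bkind J = (False, False, {j})"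
      using binterval_arm[OF J] M P False by metis
    obtain s where "b = Pt s i" using i(1)[OF bI(1)] by auto
    then have "j = i" using j(1)[OF bI(2)] by auto
    then show ?thesis using i j by simp
  qed
qed

text \<open>A coordinate caught between two with the same infinity pattern shares that pattern.
  Closeness is automatic for infinite coordinates, and for finite ones its failure is a strict drop
  by more than \<open>e\<close>, expressed in reals so that drops can be added.\<close>

lemma ereal_dichotomy:
  fixes a b c :: ereal
  assumes "b \<le> a + ereal e" "c \<le> b + ereal e" "infpat a = infpat c" "e \<ge> 0"
  shows "infpat b = infpat a \<and> (a \<le> b + ereal e \<or> real_of_ereal b < real_of_ereal a - e) \<and>
    (b \<le> c + ereal e \<or> real_of_ereal c < real_of_ereal b - e) \<and>
    real_of_ereal b \<le> real_of_ereal a + e \<and> real_of_ereal c \<le> real_of_ereal b + e"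
  using assms by (cases a; cases b; cases c) (auto simp: infpat_def)

text \<open>If \<open>J\<close> is close to neither \<open>I\<close> nor \<open>I'\<close>, then one coordinate drops by more than \<open>e\<close> from \<open>I\<close>
  to \<open>J\<close> and one from \<open>J\<close> to \<open>I'\<close>, whereas no coordinate grows by more than \<open>e\<close> at either step;
  so the sum of the coordinates decreases.\<close>
lemma bclose_dichotomy:
  assumes "bclass I = bclass I'" "bkind J = bkind I" "e \<ge> 0"
    and "co1 J \<le> co1 I + ereal e" "co2 J \<le> co2 I + ereal e"
    and "co1 I' \<le> co1 J + ereal e" "co2 I' \<le> co2 J + ereal e"
    and "bweight I \<le> bweight I'"
  shows "bclass J = bclass I \<and> (bclose e I J \<or> bclose e I' J)"
proof -
  have p: "infpat (co1 I) = infpat (co1 I')" "infpat (co2 I) = infpat (co2 I')"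
    using assms(1) by (auto simp: bclass_def)
  note d = ereal_dichotomy[OF assms(4,6) p(1) assms(3)] ereal_dichotomy[OF assms(5,7) p(2) assms(3)]
  have c: "bclass J = bclass I" using d assms(2) by (simp add: bclass_def)
  have "(co1 I \<le> co1 J + ereal e \<and> co2 I \<le> co2 J + ereal e) \<or>
    (co1 J \<le> co1 I' + ereal e \<and> co2 J \<le> co2 I' + ereal e)"
    using d assms(8) unfolding bweight_def by (smt (verit))
  then show ?thesis using c assms by (auto simp: bclose_def)
qed

text \<open>The delicate inequality is \<open>a + ereal d < b'\<close>. If
  \<open>a \<le> a'\<close>, it follows from the length of the second interval; otherwise the
  comparison of sums gives \<open>b \<le> b'\<close>, and the length of the first interval
  suffices.\<close>

lemma ereal_common_point:
  fixes a b a' b' :: ereal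
  assumes "infpat a = infpat a'" "infpat b = infpat b'" "a + ereal d < b" "a' + ereal d < b'"
    "a' \<le> a + ereal d" "b' \<le> b + ereal d" "d \<ge> 0"
    "real_of_ereal a + real_of_ereal b \<le> real_of_ereal a' + real_of_ereal b'"
  shows "\<exists>r. a < ereal r \<and> ereal r < b \<and> a' < ereal (r + d) \<and> ereal (r + d) < b'"
proof -
  have "max a (a' - ereal d) < min b (b' - ereal d)"
    using assms by (cases a; cases a'; cases b; cases b') (auto simp: infpat_def)
  then obtain r where "max a (a' - ereal d) < ereal r" "ereal r < min b (b' - ereal d)"
    using ereal_dense2 by blast
  then have "a < ereal r \<and> ereal r < b \<and> a' < ereal (r + d) \<and> ereal (r + d) < b'"
    by (cases a'; cases b') auto
  then show ?thesis ..
qed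

text \<open>This yields a point at which an entry of the composite, the shift by
  \<open>2 * e\<close>, can be evaluated.\<close>

lemma bbase_exists:
  assumes I: "binterval I" "binterval I'" and c: "bclass I = bclass I'" and e: "e \<ge> 0"
    and w: "bwide e I" "bwide e I'"
    and le: "co1 I' \<le> co1 I + ereal (2 * e)" "co2 I' \<le> co2 I + ereal (2 * e)"
    and wt: "bweight I \<le> bweight I'"
  shows "\<exists>b. b \<in> I \<and> shift (2 * e) b \<in> I' \<and> bbase I b"
proof -
  have k: "bkind I = bkind I'" using c by (simp add: bclass_def)
  note m = bkind_mem[OF k]
  consider "MInf \<in> I" | "MInf \<notin> I" "PInf \<in> I" | "MInf \<notin> I" "PInf \<notin> I" by blast
  then show ?thesis
  proof cases
    case 3
    obtain i where i: "bkind I = (False, False, {i})"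
      using binterval_arm[OF I(1) 3] by metis
    have "\<exists>r. co1 I < ereal r \<and> ereal r < co2 I \<and> co1 I' < ereal (r + 2 * e) \<and> ereal (r + 2 * e) < co2 I'"
      by (rule ereal_common_point) (use assms 3 m in \<open>auto simp: bclass_def bwide_def bweight_def\<close>)
    then obtain r where r: "co1 I < ereal r" "ereal r < co2 I"
      "co1 I' < ereal (r + 2 * e)" "ereal (r + 2 * e) < co2 I'" by blast
    have "Pt r i \<in> I" by (rule binterval_arm_mem[OF I(1) 3 i r(1,2)])
    moreover have "Pt (r + 2 * e) i \<in> I'"
      by (rule binterval_arm_mem[OF I(2) _ _ _ r(3,4)]) (use 3 m i k in auto)
    ultimately show ?thesis using 3 by (intro exI[of _ "Pt r i"]) (auto simp: bbase_def)
  qed (use m in \<open>auto simp: bbase_def\<close>)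
qed

text \<open>The two morphisms may be witnessed at unrelated points \<open>p1\<close> and
  \<open>p2\<close>. On one arm, \<open>b\<close> is pushed forward if it lies below
  \<open>p1\<close>, its shift is pulled back if it lies above \<open>p2\<close>, and otherwise that
  shift is caught between two points of \<open>J\<close>.\<close>

lemma bhom_common_point:
  assumes h: "bhom e p1 I J" "bhom e p2 J I'" and b: "b \<in> I" "shift (2 * e) b \<in> I'" "bbase I b"
    and k: "bkind J = bkind I" and I: "binterval I" "binterval J"
  shows "shift e b \<in> J"
proof -
  note m = bkind_mem[OF k]
  consider "MInf \<in> I" | "MInf \<notin> I" "PInf \<in> I" | "MInf \<notin> I" "PInf \<notin> I" by blast
  then show ?thesis
  proof cases
    case 3
    obtain i where i: "\<And>x. x \<in> I \<Longrightarrow> \<exists>r. x = Pt r i" "bkind I = (False, False, {i})"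
      using binterval_arm[OF I(1) 3] by metis
    obtain j where j: "\<And>x. x \<in> J \<Longrightarrow> \<exists>r. x = Pt r j" "bkind J = (False, False, {j})"
      using binterval_arm[OF I(2)] m 3 by metis
    have [simp]: "j = i" using i j k by auto
    have p: "p1 \<in> I" "shift e p1 \<in> J" "\<And>x. ble x p1 \<Longrightarrow> x \<in> I \<Longrightarrow> shift e x \<in> J"
      "p2 \<in> J" "\<And>y. ble p2 y \<Longrightarrow> shift e y \<in> I' \<Longrightarrow> y \<in> J"
      using h unfolding bhom_def by blast+
    obtain t where t: "b = Pt t i" using i(1)[OF b(1)] by auto
    obtain s1 where s1: "p1 = Pt s1 i" using i(1)[OF p(1)] by auto
    obtain s2 where s2: "p2 = Pt s2 i" using j(1)[OF p(4)] by auto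
    consider "t \<le> s1" | "s2 \<le> t + e" | "s1 < t" "t + e < s2" by linarith
    then show ?thesis
    proof cases
      case 1
      then show ?thesis using p(3)[of b] b by (simp add: t s1)
    next
      case 2
      have "shift e (shift e b) = shift (2 * e) b" by simp
      then have "shift e (shift e b) \<in> I'" using b(2) by (simp only:)
      moreover have "ble p2 (shift e b)" using 2 by (simp add: t s2)
      ultimately show ?thesis by (intro p(5))
    next
      case 3
      then show ?thesis
        using bconvexD[of J "shift e p1" p2 "shift e b"] p I(2) by (simp add: t s1 s2 binterval_def)
    qed
  qed (use m b in \<open>auto simp: bbase_def\<close>)
qed

lemma bkind_comparable:
  assumes "binterval I" "MInf \<notin> I" "PInf \<notin> I" "x \<in> I" "y \<in> I"
  shows "ble x y \<or> ble y x"
proof -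
  obtain i where "\<And>x. x \<in> I \<Longrightarrow> \<exists>r. x = Pt r i"
    using binterval_arm[OF assms(1-3)] by metis
  from this[OF assms(4)] this[OF assms(5)] show ?thesis by auto
qed

text \<open>A wide arm interval keeps a middle piece after losing \<open>e\<close> at each end, and
  every close interval covers that piece. Since few intervals contain a given point, this makes
  neighbourhoods finite.\<close>

lemma bclose_common_point:
  assumes I: "binterval I" and w: "bwide e I" and e: "e \<ge> 0"
  shows "\<exists>b. \<forall>J. binterval J \<and> bclose e I J \<longrightarrow> b \<in> J"
proof -
  consider "MInf \<in> I" | "PInf \<in> I" | "MInf \<notin> I" "PInf \<notin> I" by blast
  then show ?thesis
  proof cases
    case 3
    obtain i where i: "bkind I = (False, False, {i})"
      using binterval_arm[OF I(1) 3] by metis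
    have "co1 I + ereal e < co2 I - ereal e"
      using w 3 e by (cases "co1 I"; cases "co2 I") (auto simp: bwide_def)
    then obtain r where r: "co1 I + ereal e < ereal r" "ereal r < co2 I - ereal e"
      using ereal_dense2 by blast
    have "Pt r i \<in> J" if J: "binterval J" "bclose e I J" for J
    proof -
      have k: "bkind I = bkind J" using J by (auto simp: bclose_def bclass_def)
      have c: "co1 J \<le> co1 I + ereal e" "co2 I \<le> co2 J + ereal e" using J by (auto simp: bclose_def)
      have "co1 J < ereal r" using c(1) r(1) by simp
      moreover have "ereal r < co2 J"
        using c(2) r(2) by (cases "co2 I"; cases "co2 J") auto
      ultimately show ?thesis
        using binterval_arm_mem[OF J(1)] 3 bkind_mem[OF k] i k by auto
    qed
    then show ?thesis by blast
  next
    case 1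
    then have "MInf \<in> J" if "bclose e I J" for J
      using that by (auto simp: bclose_def bclass_def dest: bkind_mem)
    then show ?thesis by blast
  next
    case 2
    then have "PInf \<in> J" if "bclose e I J" for J
      using that by (auto simp: bclose_def bclass_def dest: bkind_mem)
    then show ?thesis by blast
  qed
qed

section \<open>The matching conditions for close and for narrow intervals\<close>

lemma mem_Ex_Pt:
  assumes "MInf \<in> J \<or> (\<exists>s. Pt s i \<in> J \<and> s - e \<le> r)" "PInf \<in> J \<or> (\<exists>s. Pt s i \<in> J \<and> r \<le> s + e)"
  shows "Pt r i \<in> Ex e J"
proof -
  have "Pt r i \<in> upset (shift e -` J)"
  proof (cases "MInf \<in> J")
    case True
    then show ?thesis unfolding upset_def by (auto intro!: bexI[of _ MInf])
  next
    case False
    then obtain s where "Pt s i \<in> J" "s - e \<le> r" using assms by auto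
    then show ?thesis unfolding upset_def by (auto intro!: bexI[of _ "Pt (s - e) i"])
  qed
  moreover have "Pt r i \<in> downset (shift e ` J)"
    using assms(2) unfolding downset_def by (force intro: rev_bexI)
  ultimately show ?thesis by (simp add: Ex_def)
qed

text \<open>Coordinates are suprema and infima that need not be attained. The slack between
  \<open>e\<close> and \<open>e'\<close> provides actual points of \<open>J\<close>; an extreme
  point of \<open>J\<close> serves both arms.\<close>

lemma bclose_subset_Ex:
  assumes I: "binterval I" "binterval J" and c: "bclose e I J" and e: "0 \<le> e" "e < e'"
  shows "I \<subseteq> Ex e' J"
proof -
  have k: "bkind I = bkind J" using c by (auto simp: bclose_def bclass_def)
  note m = bkind_mem[OF k]
  have hi: "\<exists>s. Pt s i \<in> J \<and> r \<le> s + e'"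
    if "Pt r i \<in> I" "Sup (arm_pts i I) \<le> Sup (arm_pts i J) + ereal e" for r i
  proof -
    have "ereal r \<le> Sup (arm_pts i I)" using that(1) by (intro Sup_upper) (auto simp: arm_pts_def)
    then have "ereal r \<le> Sup (arm_pts i J) + ereal e" using that(2) by simp
    then have "ereal (r - e') < Sup (arm_pts i J)"
      using e by (cases "Sup (arm_pts i J)") auto
    then obtain s where "Pt s i \<in> J" "r - e' < s" by (auto simp: less_Sup_iff arm_pts_def)
    then show ?thesis by (intro exI[of _ s]) auto
  qed
  have lo: "\<exists>s. Pt s i \<in> J \<and> s - e' \<le> r"
    if "Pt r i \<in> I" "Inf (arm_pts i J) \<le> Inf (arm_pts i I) + ereal e" for r i
  proof -
    have "Inf (arm_pts i I) \<le> ereal r" using that(1) by (intro Inf_lower) (auto simp: arm_pts_def)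
    then have "Inf (arm_pts i I) + ereal e < ereal (r + e')"
      using e by (cases "Inf (arm_pts i I)") auto
    then have "Inf (arm_pts i J) < ereal (r + e')" using that(2) by simp
    then obtain s where "Pt s i \<in> J" "s < r + e'" by (auto simp: Inf_less_iff arm_pts_def)
    then show ?thesis by (intro exI[of _ s]) auto
  qed
  have co: "co1 I \<le> co1 J + ereal e" "co1 J \<le> co1 I + ereal e"
     "co2 I \<le> co2 J + ereal e" "co2 J \<le> co2 I + ereal e"
    using c by (auto simp: bclose_def)
  have ends: "b \<in> Ex e' J" if b: "b \<in> J" "b = MInf \<or> b = PInf" for b
  proof -
    have s: "shift e' b = b" using b(2) by auto
    have "b \<in> upset (shift e' -` J)" unfolding upset_def using b(1) s by (auto intro!: bexI[of _ b])
    moreover have "b \<in> shift e' ` J" using b(1) s by (metis imageI)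
    then have "b \<in> downset (shift e' ` J)" unfolding downset_def using ble_refl by blast
    ultimately show ?thesis by (simp add: Ex_def)
  qed
  consider "MInf \<in> I" "PInf \<in> I" | "MInf \<in> I" "PInf \<notin> I" | "MInf \<notin> I" "PInf \<in> I"
    | "MInf \<notin> I" "PInf \<notin> I" by blast
  then show ?thesis
  proof cases
    case 1
    show ?thesis
    proof
      fix x assume "x \<in> I"
      then show "x \<in> Ex e' J" using ends 1 m by (cases x) (auto intro: mem_Ex_Pt)
    qed
  next
    case 2
    have "Sup (arm_pts i I) \<le> Sup (arm_pts i J) + ereal e" for i
      using co 2 m by (cases i) (auto simp: co1_def co2_def)
    note hi' = hi[OF _ this]
    show ?thesis
    proof
      fix x assume "x \<in> I"
      then show "x \<in> Ex e' J" using ends 2 m hi' by (cases x) (auto intro: mem_Ex_Pt)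
    qed
  next
    case 3
    have "Inf (arm_pts i J) \<le> Inf (arm_pts i I) + ereal e" for i
      using co 3 m by (cases i) (auto simp: co1_def co2_def)
    note lo' = lo[OF _ this]
    show ?thesis
    proof
      fix x assume "x \<in> I"
      then show "x \<in> Ex e' J" using ends 3 m lo' by (cases x) (auto intro: mem_Ex_Pt)
    qed
  next
    case 4
    obtain i where i: "\<And>x. x \<in> I \<Longrightarrow> \<exists>r. x = Pt r i" "arm_pts One I \<union> arm_pts Two I = arm_pts i I"
      "bkind I = (False, False, {i})"
      using binterval_arm[OF I(1) 4] by metis
    obtain j where j: "arm_pts One J \<union> arm_pts Two J = arm_pts j J" "bkind J = (False, False, {j})"
      using binterval_arm[OF I(2)] 4 m by metis
    have [simp]: "j = i" using i(3) j(2) k by auto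
    have "Sup (arm_pts i I) \<le> Sup (arm_pts i J) + ereal e" "Inf (arm_pts i J) \<le> Inf (arm_pts i I) + ereal e"
      using co 4 m i(2) j(1) by (auto simp: co1_def co2_def)
    note hi' = hi[OF _ this(1)] and lo' = lo[OF _ this(2)]
    show ?thesis
    proof
      fix x assume "x \<in> I"
      then show "x \<in> Ex e' J" using i(1)[of x] hi' lo' by (auto intro: mem_Ex_Pt)
    qed
  qed
qed

lemma intmod_trivial_if_not_bwide:
  assumes I: "binterval I" and w: "\<not> bwide e I" and e: "e < e'"
  shows "intmod_trivial TYPE('k::field) (2 * e') I"
proof -
  have n: "MInf \<notin> I" "PInf \<notin> I" using w by (auto simp: bwide_def)
  obtain i where i: "\<And>x. x \<in> I \<Longrightarrow> \<exists>r. x = Pt r i" "arm_pts One I \<union> arm_pts Two I = arm_pts i I"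
    using binterval_arm[OF I(1) n] by metis
  have "shift (2 * e') b \<notin> I" if b: "b \<in> I" for b
  proof
    assume s: "shift (2 * e') b \<in> I"
    obtain r where r: "b = Pt r i" using i b by auto
    have "Inf (arm_pts i I) \<le> ereal r" using b by (intro Inf_lower) (auto simp: arm_pts_def r)
    moreover have "ereal (r + 2 * e') \<le> Sup (arm_pts i I)"
      using s by (intro Sup_upper) (auto simp: arm_pts_def r)
    ultimately have "Inf (arm_pts i I) + ereal (2 * e) < Sup (arm_pts i I)"
      using e by (cases "Inf (arm_pts i I)"; cases "Sup (arm_pts i I)") auto
    then show False using w n i(2) by (simp add: bwide_def co1_def co2_def)
  qed
  then show ?thesis by (auto simp: intmod_trivial_def intmod_map_def)
qed

section \<open>Interleaved interval sums and Hall's condition\<close>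

text \<open>\<open>A b q p\<close> is the \<open>q\<close>-coordinate of the image of the \<open>p\<close>-th basis vector at \<open>b\<close> under a morphism
  from the interval module sum over \<open>m\<close> to the \<open>e\<close>-shift of the one over \<open>n\<close>.\<close>
locale shift_matrix =
  fixes e :: real and m n :: "bpt set \<Rightarrow> nat"
    and A :: "bpt \<Rightarrow> bpt set \<times> nat \<Rightarrow> bpt set \<times> nat \<Rightarrow> 'k::field"
  assumes binterval: "p \<in> melems m \<Longrightarrow> binterval (fst p)"
    and support: "A b q p \<noteq> 0 \<Longrightarrow> p \<in> melems m \<and> b \<in> fst p \<and> q \<in> melems n \<and> shift e b \<in> fst q"
    and natural: "p \<in> melems m \<Longrightarrow> b \<in> fst p \<Longrightarrow> ble b b' \<Longrightarrow>
      A b' q p = (if shift e b' \<in> fst q then A b q p else 0)"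
begin

text \<open>By naturality a nonzero entry stays nonzero down to any \<open>x\<close> in the source
  interval and up to any \<open>y\<close> whose shift lies in the target interval;
  \<open>support\<close> then supplies the missing membership.\<close>

lemma bhom:
  assumes "A b q p \<noteq> 0" shows "bhom e b (fst p) (fst q)"
proof -
  note s = support[OF assms]
  have "shift e x \<in> fst q" if "ble x b" "x \<in> fst p" for x
  proof -
    have "A b q p = A x q p" using natural[of p x b q] that s by simp
    then show ?thesis using support[of x q p] assms by simp
  qed
  moreover have "y \<in> fst p" if "ble b y" "shift e y \<in> fst q" for y
  proof -
    have "A y q p = A b q p" using natural[of p b y q] that s by simp
    then show ?thesis using support[of y q p] assms by simp
  qed
  ultimately show ?thesis using s by (auto simp: bhom_def)
qed

text \<open>Points on different arms are incomparable, so their entries are compared through an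
  extreme point: the bottom if the source contains it, or else the top, which then lies in both
  intervals because their kinds agree.\<close>

lemma entry_eq:
  assumes p: "p \<in> melems m" and k: "bkind (fst p) = bkind (fst q)"
    and b: "b \<in> fst p" "shift e b \<in> fst q" and b': "b' \<in> fst p" "shift e b' \<in> fst q"
  shows "A b q p = A b' q p"
proof -
  have mono: "A x q p = A y q p"
    if "ble x y" "x \<in> fst p" "shift e y \<in> fst q" for x y
    using natural[of p x y q] that p by simp
  consider "MInf \<in> fst p" | "PInf \<in> fst p" | "MInf \<notin> fst p" "PInf \<notin> fst p" by blast
  then show ?thesis
  proof cases
    case 1
    then show ?thesis using mono[of MInf b] mono[of MInf b'] b b' by simp
  next
    case 2
    then have "PInf \<in> fst q" using bkind_mem[OF k] by simp
    then show ?thesis using mono[of b PInf] mono[of b' PInf] b b' by simp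
  next
    case 3
    then have "ble b b' \<or> ble b' b" using bkind_comparable[OF binterval[OF p]] b b' by blast
    then show ?thesis using mono[of b b'] mono[of b' b] b b' by auto
  qed
qed

text \<open>A single scalar per pair, independent of the point chosen by \<open>entry_eq\<close>.
  Entries between different classes are dropped, so weights are only ever compared within a
  class.\<close>

definition coeff :: "bpt set \<times> nat \<Rightarrow> bpt set \<times> nat \<Rightarrow> 'k" where
  "coeff q p = (if bclass (fst p) = bclass (fst q) \<and> (\<exists>b. A b q p \<noteq> 0)
     then A (SOME b. A b q p \<noteq> 0) q p else 0)"

lemma coeff_eq:
  assumes p: "p \<in> melems m" and k: "bclass (fst p) = bclass (fst q)"
    and b: "b \<in> fst p" "shift e b \<in> fst q"
  shows "coeff q p = A b q p"
proof (cases "\<exists>b. A b q p \<noteq> 0")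
  case True
  define b' where "b' = (SOME b. A b q p \<noteq> 0)"
  have "A b' q p \<noteq> 0" unfolding b'_def using someI_ex[OF True] .
  then have "A b' q p = A b q p"
    using entry_eq[OF p _ _ _ b] k support by (auto simp: bclass_def)
  then show ?thesis using k True by (simp add: coeff_def b'_def)
qed (auto simp: coeff_def)

lemma coeff_bhom:
  assumes "coeff q p \<noteq> 0"
  shows "bclass (fst p) = bclass (fst q) \<and> (\<exists>b. bbase (fst p) b \<and> bhom e b (fst p) (fst q))"
proof -
  obtain b where b: "A b q p \<noteq> 0" and c: "bclass (fst p) = bclass (fst q)"
    using assms by (auto simp: coeff_def split: if_splits)
  note s = support[OF b]
  have k: "bkind (fst p) = bkind (fst q)" using c by (simp add: bclass_def)
  consider "MInf \<in> fst p" | "MInf \<notin> fst p" "PInf \<in> fst p" | "MInf \<notin> fst p" "PInf \<notin> fst p" by blast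
  then have "\<exists>b. bbase (fst p) b \<and> A b q p \<noteq> 0"
  proof cases
    case 1
    then have "A MInf q p = A b q p" using entry_eq[OF _ k, of MInf b] s bkind_mem[OF k] by simp
    then show ?thesis using 1 b by (intro exI[of _ MInf]) (auto simp: bbase_def)
  next
    case 2
    then have "A PInf q p = A b q p" using entry_eq[OF _ k, of PInf b] s bkind_mem[OF k] by simp
    then show ?thesis using 2 b by (intro exI[of _ PInf]) (auto simp: bbase_def)
  next
    case 3
    then show ?thesis using b by (auto simp: bbase_def)
  qed
  then show ?thesis using bhom c by blast
qed

end

text \<open>One half of an interleaving: \<open>B\<close> after \<open>A\<close> is the structure
  map for the shift by \<open>2 * e\<close>, which is the identity on the summands that survive and
  zero on the rest. The other half is an instance with the roles exchanged.\<close>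

locale shift_matrix_inverse =
  F: shift_matrix e m n A + G: shift_matrix e n m B
  for e m n and A B :: "bpt \<Rightarrow> bpt set \<times> nat \<Rightarrow> bpt set \<times> nat \<Rightarrow> 'k::field" +
  assumes nonneg: "e \<ge> 0"
    and finite_at: "finite {q \<in> melems n. b \<in> fst q}"
    and product: "p \<in> melems m \<Longrightarrow> p' \<in> melems m \<Longrightarrow> b \<in> fst p \<Longrightarrow>
      (\<Sum>q | q \<in> melems n \<and> shift e b \<in> fst q. B (shift e b) p' q * A b q p) =
      (if p' = p \<and> shift (2 * e) b \<in> fst p then 1 else 0)"
begin

definition nbrs :: "bpt set \<times> nat \<Rightarrow> (bpt set \<times> nat) set" where
  "nbrs p = {q \<in> melems n. bclose e (fst p) (fst q)}"

lemma finite_nbrs: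
  assumes "p \<in> melems m" "bwide e (fst p)" shows "finite (nbrs p)"
proof -
  obtain b where "\<forall>J. binterval J \<and> bclose e (fst p) J \<longrightarrow> b \<in> J"
    using bclose_common_point[OF F.binterval[OF assms(1)] assms(2) nonneg] by blast
  then have "nbrs p \<subseteq> {q \<in> melems n. b \<in> fst q}" using G.binterval by (auto simp: nbrs_def)
  then show ?thesis using finite_at finite_subset by blast
qed

text \<open>The sum over neighbours agrees with the sum over all indices alive at the shifted base
  point, whose value is given by \<open>product\<close>. A term present in only one of the two sums
  vanishes: by the weight dichotomy on one side, by \<open>bhom_common_point\<close> on the
  other.\<close>

lemma sum_coeff:
  assumes S: "S \<subseteq> {p \<in> melems m. bwide e (fst p)}" "finite S" and p: "p \<in> S" "p' \<in> S"
    and c: "bclass (fst p) = bclass (fst p')" and wt: "bweight (fst p) \<le> bweight (fst p')"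
    and b: "b \<in> fst p" "shift (2 * e) b \<in> fst p'" "bbase (fst p) b"
  shows "(\<Sum>q\<in>\<Union>(nbrs ` S). G.coeff p' q * F.coeff q p) = (if p' = p then 1 else 0)"
proof -
  define T where "T = \<Union>(nbrs ` S)"
  define T' where "T' = {q. q \<in> melems n \<and> shift e b \<in> fst q}"
  have fT: "finite T" using S finite_nbrs by (auto simp: T_def)
  have fT': "finite T'" using finite_at by (simp add: T'_def)
  have pm: "p \<in> melems m" "p' \<in> melems m" using S p by auto
  have bb: "shift e (shift e b) \<in> fst p'" using b by simp
  have close: "bclass (fst q) = bclass (fst p) \<and> (bclose e (fst p) (fst q) \<or> bclose e (fst p') (fst q))"
    if q: "B (shift e b) p' q * A b q p \<noteq> 0" for q
  proof -
    have h: "bhom e b (fst p) (fst q)" "bhom e (shift e b) (fst q) (fst p')" "q \<in> melems n"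
      using F.bhom[of b q p] G.bhom[of "shift e b" p' q] F.support[of b q p] q by auto
    have k: "bkind (fst p) = bkind (fst p')" using c by (simp add: bclass_def)
    have kq: "bkind (fst q) = bkind (fst p)"
      by (rule bhom_comp_kind[OF h(1,2) k b(3) F.binterval[OF pm(1)] G.binterval[OF h(3)]])
    have b': "bbase (fst q) (shift e b)" using b(3) bkind_mem[OF kq] by (auto simp: bbase_def)
    show ?thesis
      using bclose_dichotomy[OF c kq nonneg _ _ _ _ wt]
        bhom_co_le[OF h(1) kq[symmetric] b(3) F.binterval[OF pm(1)] G.binterval[OF h(3)]]
        bhom_co_le[OF h(2) _ b' G.binterval[OF h(3)] F.binterval[OF pm(2)]] kq k
      by simp
  qed
  have "(\<Sum>q\<in>T. G.coeff p' q * F.coeff q p) = (\<Sum>q\<in>T'. B (shift e b) p' q * A b q p)"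
  proof (rule sum.mono_neutral_cong[OF fT' fT])
    fix q assume q: "q \<in> T' - T"
    show "B (shift e b) p' q * A b q p = 0"
      using close[of q] q p by (auto simp: T'_def T_def nbrs_def)
  next
    fix q assume q: "q \<in> T - T'"
    show "G.coeff p' q * F.coeff q p = 0"
    proof (rule ccontr)
      assume nz: "G.coeff p' q * F.coeff q p \<noteq> 0"
      then obtain b1 b2 where h: "bhom e b1 (fst p) (fst q)" "bhom e b2 (fst q) (fst p')"
        "bclass (fst p) = bclass (fst q)"
        using F.coeff_bhom[of q p] G.coeff_bhom[of p' q] by auto
      have qn: "q \<in> melems n" using q by (auto simp: T_def nbrs_def)
      have "shift e b \<in> fst q"
        by (rule bhom_common_point[OF h(1,2) b _ F.binterval[OF pm(1)] G.binterval[OF qn]])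
          (use h(3) in \<open>simp add: bclass_def\<close>)
      then show False using q qn by (simp add: T'_def)
    qed
  next
    fix q assume q: "q \<in> T \<inter> T'"
    then have qn: "q \<in> melems n" "shift e b \<in> fst q" by (auto simp: T'_def)
    show "G.coeff p' q * F.coeff q p = B (shift e b) p' q * A b q p"
    proof (cases "bclass (fst p) = bclass (fst q)")
      case True
      then show ?thesis
        using F.coeff_eq[OF pm(1) True b(1) qn(2)] G.coeff_eq[OF qn(1) _ qn(2) bb] c by simp
    next
      case False
      \<comment> \<open>A term through a different class is zero on both sides: \<open>coeff\<close>
        drops it by definition, and by \<open>close\<close> it does not contribute to the
        composite.\<close>
      then show ?thesis using close[of q] by (auto simp: F.coeff_def)
    qed
  qed
  also have "\<dots> = (if p' = p \<and> shift (2 * e) b \<in> fst p then 1 else 0)"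
    unfolding T'_def by (rule product[OF pm b(1)])
  finally show ?thesis using b by (auto simp: T_def)
qed

text \<open>Restricted to \<open>S\<close> and its neighbours, the product of the coefficient
  matrices is unitriangular with respect to weight, so the rank bound applies.\<close>

lemma hall_condition:
  assumes S: "S \<subseteq> {p \<in> melems m. bwide e (fst p)}" "finite S"
  shows "card S \<le> card (\<Union>(nbrs ` S))"
proof (rule card_le_unitriangular_factorization[where \<alpha> = "\<lambda>p. bweight (fst p)"])
  show "finite S" "finite (\<Union>(nbrs ` S))" using S finite_nbrs by auto
next
  fix p assume p: "p \<in> S"
  then have pm: "p \<in> melems m" "bwide e (fst p)" using S by auto
  have le: "x \<le> x + ereal (2 * e)" for x :: ereal using nonneg by (cases x) auto
  obtain b where "b \<in> fst p" "shift (2 * e) b \<in> fst p" "bbase (fst p) b"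
    using bbase_exists[OF F.binterval[OF pm(1)] F.binterval[OF pm(1)] refl nonneg pm(2,2) le le] by blast
  from sum_coeff[OF S p p refl _ this]
  show "(\<Sum>q\<in>\<Union> (nbrs ` S). G.coeff p q * F.coeff q p) = 1" by simp
next
  fix p p' assume p: "p \<in> S" "p' \<in> S" "p \<noteq> p'" and wt: "bweight (fst p) \<le> bweight (fst p')"
  then have pm: "p \<in> melems m" "bwide e (fst p)" "p' \<in> melems m" "bwide e (fst p')" using S by auto
  show "(\<Sum>q\<in>\<Union> (nbrs ` S). G.coeff p' q * F.coeff q p) = 0"
  proof (rule ccontr)
    \<comment> \<open>A nonzero sum has a nonzero term. That term puts \<open>p\<close> and
      \<open>p'\<close> in one class and bounds their coordinates within \<open>2 * e\<close>, which
      is what \<open>bbase_exists\<close> requires; \<open>sum_coeff\<close> then makes the sum zero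
      after all.\<close>
    assume nz: "\<not> ?thesis"
    obtain q where q: "q \<in> \<Union> (nbrs ` S)" "G.coeff p' q * F.coeff q p \<noteq> 0"
      using sum.not_neutral_contains_not_neutral[OF nz] by blast
    have qn: "q \<in> melems n" using q by (auto simp: nbrs_def)
    obtain b1 b2 where h: "bhom e b1 (fst p) (fst q)" "bbase (fst p) b1"
      "bhom e b2 (fst q) (fst p')" "bbase (fst q) b2"
      and c: "bclass (fst p) = bclass (fst q)" "bclass (fst q) = bclass (fst p')"
      using q F.coeff_bhom[of q p] G.coeff_bhom[of p' q] by auto
    have k: "bkind (fst p) = bkind (fst q)" "bkind (fst q) = bkind (fst p')"
      using c by (auto simp: bclass_def)
    note le = bhom_co_le[OF h(1) k(1) h(2) F.binterval[OF pm(1)] G.binterval[OF qn]]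
      bhom_co_le[OF h(3) k(2) h(4) G.binterval[OF qn] F.binterval[OF pm(3)]]
    have add: "z \<le> x + ereal (2 * e)" if "y \<le> x + ereal e" "z \<le> y + ereal e" for x y z :: ereal
      using that by (cases x; cases y; cases z) auto
    obtain b where b: "b \<in> fst p" "shift (2 * e) b \<in> fst p'" "bbase (fst p) b"
      using bbase_exists[OF F.binterval[OF pm(1)] F.binterval[OF pm(3)] _ nonneg pm(2,4) _ _ wt]
        add le c by metis
    from sum_coeff[OF S p(1,2) _ wt b] c nz p(3) show False by simp
  qed
qed

lemma injection:
  "\<exists>\<sigma>. inj_on \<sigma> {p \<in> melems m. bwide e (fst p)} \<and>
    (\<forall>p\<in>{p \<in> melems m. bwide e (fst p)}. \<sigma> p \<in> nbrs p)"
  by (rule rado_selection_finite_degree) (use finite_nbrs hall_condition in auto)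

end

lemma lam_matching_if_interleaved:
  assumes AB: "shift_matrix_inverse e m n A B" and BA: "shift_matrix_inverse e n m B' A'"
    and e: "e < e'"
  shows "lam_matching TYPE('k::field) e' m n"
proof -
  interpret F: shift_matrix_inverse e m n A B by (rule AB)
  interpret G: shift_matrix_inverse e n m B' A' by (rule BA)
  obtain f where f: "inj_on f {p \<in> melems m. bwide e (fst p)}"
    "\<And>p. p \<in> {p \<in> melems m. bwide e (fst p)} \<Longrightarrow> f p \<in> F.nbrs p"
    using F.injection by blast
  obtain g where g: "inj_on g {p \<in> melems n. bwide e (fst p)}"
    "\<And>p. p \<in> {p \<in> melems n. bwide e (fst p)} \<Longrightarrow> g p \<in> G.nbrs p"
    using G.injection by blast
  obtain C D \<sigma> where \<sigma>: "{p \<in> melems m. bwide e (fst p)} \<subseteq> C" "C \<subseteq> melems m"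
    "{p \<in> melems n. bwide e (fst p)} \<subseteq> D" "D \<subseteq> melems n" "bij_betw \<sigma> C D"
    "\<forall>p\<in>C. bclose e (fst p) (fst (\<sigma> p))"
    using mendelsohn_dulmage[OF f(1) _ g(1), of "melems n" "\<lambda>p q. bclose e (fst p) (fst q)" "melems m"]
      f(2) g(2) unfolding F.nbrs_def G.nbrs_def by (auto simp: bclose_sym)
  show ?thesis
    unfolding lam_matching_def
  proof (intro exI conjI ballI)
    show "C \<subseteq> melems m" "D \<subseteq> melems n" "bij_betw \<sigma> C D" by fact+
    show "intmod_trivial TYPE('k) (2 * e') (fst p)" if "p \<in> melems m - C" for p
      using that \<sigma>(1) e by (intro intmod_trivial_if_not_bwide[of _ e] F.F.binterval) auto
    show "intmod_trivial TYPE('k) (2 * e') (fst p)" if "p \<in> melems n - D" for p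
      using that \<sigma>(3) e by (intro intmod_trivial_if_not_bwide[of _ e] G.F.binterval) auto
    fix p assume p: "p \<in> C"
    have "\<sigma> p \<in> D" using \<sigma>(5) p by (rule bij_betw_apply)
    then have i: "binterval (fst p)" "binterval (fst (\<sigma> p))"
      using p \<sigma>(2,4) F.F.binterval G.F.binterval by blast+
    have c: "bclose e (fst p) (fst (\<sigma> p))" "bclose e (fst (\<sigma> p)) (fst p)"
      using \<sigma>(6) p bclose_sym by blast+
    show "fst p \<subseteq> Ex e' (fst (\<sigma> p))" by (rule bclose_subset_Ex[OF i c(1) F.nonneg e])
    show "fst (\<sigma> p) \<subseteq> Ex e' (fst p)" by (rule bclose_subset_Ex[OF i(2,1) c(2) F.nonneg e])
  qed
qed

section \<open>From morphisms of interval sums to matrices\<close>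

definition unit_vec :: "'i \<Rightarrow> 'i \<Rightarrow> 'k::field" where
  "unit_vec p = (\<lambda>q. if q = p then 1 else 0)"

lemma unit_vec_dsum: "p \<in> melems m \<Longrightarrow> b \<in> fst p \<Longrightarrow> unit_vec p \<in> dsum_space m b"
  by (auto simp: dsum_space_def unit_vec_def melems_def)

lemma dsum_map_apply: "dsum_map b b' x p = intmod_map (fst p) b b' (x p)"
  by (cases p) (simp add: dsum_map_def)

lemma dsum_spaceD:
  assumes "x \<in> dsum_space m b" "x p \<noteq> 0" shows "p \<in> melems m" "b \<in> fst p"
  using assms by (cases p; auto simp: dsum_space_def melems_def)+

locale shift_morphism =
  fixes e :: real and m n :: "bpt set \<Rightarrow> nat"
    and \<Phi> :: "bpt \<Rightarrow> (bpt set \<times> nat \<Rightarrow> 'k::field) \<Rightarrow> bpt set \<times> nat \<Rightarrow> 'k"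
  assumes maps: "x \<in> dsum_space m b \<Longrightarrow> \<Phi> b x \<in> dsum_space n (shift e b)"
    and additive: "x \<in> dsum_space m b \<Longrightarrow> y \<in> dsum_space m b \<Longrightarrow> \<Phi> b (x + y) = \<Phi> b x + \<Phi> b y"
    and homogeneous: "x \<in> dsum_space m b \<Longrightarrow> \<Phi> b (\<lambda>p. r * x p) = (\<lambda>q. r * \<Phi> b x q)"
    and natural: "ble b b' \<Longrightarrow> x \<in> dsum_space m b \<Longrightarrow>
      \<Phi> b' (dsum_map b b' x) = dsum_map (shift e b) (shift e b') (\<Phi> b x)"
begin

text \<open>Away from the interval of \<open>p\<close> the unit vector is not in the space at
  \<open>b\<close>, and the value 0 is what \<open>support\<close> demands there.\<close>

definition entry :: "bpt \<Rightarrow> bpt set \<times> nat \<Rightarrow> bpt set \<times> nat \<Rightarrow> 'k" where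
  "entry b q p = (if p \<in> melems m \<and> b \<in> fst p then \<Phi> b (unit_vec p) q else 0)"

lemma zero_mem: "(\<lambda>_. 0) \<in> dsum_space m b"
  by (auto simp: dsum_space_def)

lemma \<Phi>_zero: "\<Phi> b (\<lambda>_. 0) = (\<lambda>_. 0)"
  using homogeneous[OF zero_mem, of b 0] by simp

lemma expand:
  assumes "finite U" "\<And>p. p \<in> U \<Longrightarrow> p \<in> melems m \<and> b \<in> fst p" "\<And>p. p \<notin> U \<Longrightarrow> x p = 0"
  shows "\<Phi> b x q = (\<Sum>p\<in>U. entry b q p * x p)"
  using assms
proof (induction U arbitrary: x rule: finite_induct)
  case empty
  then have "x = (\<lambda>_. 0)" by auto
  then show ?case by (simp add: \<Phi>_zero)
next
  case (insert p U)
  define y where "y = x(p := 0)"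
  have IH: "\<Phi> b y q = (\<Sum>p\<in>U. entry b q p * y p)"
    by (rule insert.IH) (use insert.prems in \<open>auto simp: y_def\<close>)
  have "{r. y r \<noteq> 0} \<subseteq> U" using insert.prems by (auto simp: y_def split: if_splits)
  then have "finite {r. y r \<noteq> 0}" using insert.hyps(1) finite_subset by blast
  moreover have "b \<in> I \<and> j < m I" if "y (I, j) \<noteq> 0" for I j
  proof -
    have "(I, j) \<in> U" using that insert.prems(2)[of "(I, j)"] by (auto simp: y_def split: if_splits)
    then show ?thesis using insert.prems(1)[of "(I, j)"] by (auto simp: melems_def)
  qed
  ultimately have y: "y \<in> dsum_space m b" by (auto simp: dsum_space_def)
  have p: "p \<in> melems m" "b \<in> fst p" using insert.prems(1)[of p] by auto
  note u = unit_vec_dsum[OF p]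
  have u': "(\<lambda>r. x p * unit_vec p r) \<in> dsum_space m b"
    using p by (auto simp: dsum_space_def unit_vec_def melems_def)
  have "x = (\<lambda>r. x p * unit_vec p r) + y" by (auto simp: y_def unit_vec_def)
  then have "\<Phi> b x = (\<lambda>q. x p * \<Phi> b (unit_vec p) q) + \<Phi> b y"
    using additive[OF u' y] homogeneous[OF u, of "x p"] by simp
  then have "\<Phi> b x q = entry b q p * x p + \<Phi> b y q" using p by (simp add: entry_def)
  also have "\<Phi> b y q = (\<Sum>p\<in>U. entry b q p * x p)"
    unfolding IH by (rule sum.cong) (use insert.hyps in \<open>auto simp: y_def\<close>)
  finally show ?case using insert.hyps by simp
qed

lemma shift_matrix_entry:
  assumes "\<And>I. m I > 0 \<Longrightarrow> binterval I"
  shows "shift_matrix e m n entry"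
proof
  show "binterval (fst p)" if "p \<in> melems m" for p using assms that by (auto simp: melems_def)
  show supp: "p \<in> melems m \<and> b \<in> fst p \<and> q \<in> melems n \<and> shift e b \<in> fst q"
    if "entry b q p \<noteq> 0" for b q p
  proof -
    have p: "p \<in> melems m" "b \<in> fst p" and nz: "\<Phi> b (unit_vec p) q \<noteq> 0"
      using that by (auto simp: entry_def split: if_splits)
    show ?thesis using p dsum_spaceD[OF maps[OF unit_vec_dsum[OF p]] nz] by simp
  qed
  fix p b b' q assume p: "p \<in> melems m" "b \<in> fst p" and le: "ble b b'"
  \<comment> \<open>The structure map fixes the unit vector while its interval lasts and kills it
    afterwards; the second case matches the default value of \<open>entry\<close>.\<close>
  have "entry b' q p = \<Phi> b' (dsum_map b b' (unit_vec p)) q"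
  proof (cases "b' \<in> fst p")
    case True
    have "dsum_map b b' (unit_vec p) = (unit_vec p :: _ \<Rightarrow> 'k)"
      using p True by (auto simp: fun_eq_iff dsum_map_apply unit_vec_def intmod_map_def)
    then show ?thesis using p True by (simp add: entry_def)
  next
    case False
    have "dsum_map b b' (unit_vec p) = (\<lambda>_. 0 :: 'k)"
      using False by (auto simp: fun_eq_iff dsum_map_apply unit_vec_def intmod_map_def)
    then show ?thesis using False by (simp add: entry_def \<Phi>_zero)
  qed
  also have "\<dots> = intmod_map (fst q) (shift e b) (shift e b') (entry b q p)"
    using natural[OF le unit_vec_dsum[OF p]] p by (simp add: dsum_map_apply entry_def)
  also have "\<dots> = (if shift e b' \<in> fst q then entry b q p else 0)"
    using supp[of b q p] by (auto simp: intmod_map_def)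
  finally show "entry b' q p = (if shift e b' \<in> fst q then entry b q p else 0)" .
qed

end

text \<open>Applying the composite to a unit vector and expanding the intermediate vector in
  coordinates gives the matrix product. Pointwise finiteness of \<open>n\<close> makes the sum over
  all live indices legitimate.\<close>

lemma shift_matrix_inverse_entry:
  assumes F: "shift_morphism e m n \<Phi>" and G: "shift_morphism e n m \<Psi>" and e: "e \<ge> 0"
    and int: "\<And>I. m I > 0 \<Longrightarrow> binterval I" "\<And>I. n I > 0 \<Longrightarrow> binterval I"
    and fin: "\<And>b. finite {q \<in> melems n. b \<in> fst q}"
    and comp: "\<And>b x. x \<in> dsum_space m b \<Longrightarrow> \<Psi> (shift e b) (\<Phi> b x) = dsum_map b (shift (2 * e) b) x"
  shows "shift_matrix_inverse e m n (shift_morphism.entry m \<Phi>) (shift_morphism.entry n \<Psi>)"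
proof -
  interpret F: shift_morphism e m n \<Phi> by (rule F)
  interpret G: shift_morphism e n m \<Psi> by (rule G)
  interpret FM: shift_matrix e m n F.entry by (rule F.shift_matrix_entry[OF int(1)])
  interpret GM: shift_matrix e n m G.entry by (rule G.shift_matrix_entry[OF int(2)])
  show ?thesis
  proof
    show "e \<ge> 0" by (rule e)
    show "finite {q \<in> melems n. b \<in> fst q}" for b by (rule fin)
    fix p p' b assume p: "p \<in> melems m" "b \<in> fst p"
    note u = unit_vec_dsum[OF p]
    have "(\<Sum>q | q \<in> melems n \<and> shift e b \<in> fst q. G.entry (shift e b) p' q * F.entry b q p) =
      (\<Sum>q | q \<in> melems n \<and> shift e b \<in> fst q. G.entry (shift e b) p' q * \<Phi> b (unit_vec p) q)"
      using p by (simp add: F.entry_def)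
    also have "\<dots> = \<Psi> (shift e b) (\<Phi> b (unit_vec p)) p'"
    proof (rule G.expand[symmetric])
      show "\<Phi> b (unit_vec p) q = 0" if "q \<notin> {q. q \<in> melems n \<and> shift e b \<in> fst q}" for q
        using dsum_spaceD[OF F.maps[OF u], of q] that by blast
    qed (use fin in simp_all)
    also have "\<dots> = (if p' = p \<and> shift (2 * e) b \<in> fst p then 1 else 0)"
      unfolding comp[OF u] using p by (auto simp: dsum_map_apply unit_vec_def intmod_map_def)
    finally show "(\<Sum>q | q \<in> melems n \<and> shift e b \<in> fst q. G.entry (shift e b) p' q * F.entry b q p) =
      (if p' = p \<and> shift (2 * e) b \<in> fst p then 1 else 0)" .
  qed
qed

section \<open>Homology of sublevel sets\<close>

text \<open>The defining sum runs over the support, which varies with the chain; a common finite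
  superset makes the boundaries of several chains comparable term by term.\<close>

lemma kboundary_superset:
  assumes "finite U" "{\<sigma>. c \<sigma> \<noteq> 0} \<subseteq> U"
  shows "kboundary p c \<tau> = (if p = 0 then 0 else
    \<Sum>\<sigma>\<in>U. \<Sum>i\<le>p. if singular_face p i \<sigma> = \<tau> then (-1) ^ i * c \<sigma> else 0)"
proof -
  have "(\<Sum>\<sigma>\<in>{\<sigma>. c \<sigma> \<noteq> 0}. \<Sum>i\<le>p. if singular_face p i \<sigma> = \<tau> then (-1) ^ i * c \<sigma> else 0) =
    (\<Sum>\<sigma>\<in>U. \<Sum>i\<le>p. if singular_face p i \<sigma> = \<tau> then (-1) ^ i * c \<sigma> else 0)"
    by (rule sum.mono_neutral_left[OF assms]) (intro ballI sum.neutral, simp)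
  then show ?thesis by (simp add: kboundary_def)
qed

lemma kchains_add:
  assumes "c \<in> kchains p X" "d \<in> kchains p X" shows "c + d \<in> kchains p X"
proof -
  have "{\<sigma>. (c + d) \<sigma> \<noteq> 0} \<subseteq> {\<sigma>. c \<sigma> \<noteq> 0} \<union> {\<sigma>. d \<sigma> \<noteq> 0}" by auto
  moreover from this have "finite {\<sigma>. (c + d) \<sigma> \<noteq> 0}"
    by (rule finite_subset) (use assms in \<open>auto simp: kchains_def\<close>)
  ultimately show ?thesis using assms by (simp add: kchains_def) blast
qed

lemma kchains_smult: "c \<in> kchains p X \<Longrightarrow> (\<lambda>\<sigma>. r * c \<sigma>) \<in> kchains p X"
  unfolding kchains_def
  by (auto intro!: finite_subset[of "{\<sigma>. r \<noteq> 0 \<and> c \<sigma> \<noteq> 0}" "{\<sigma>. c \<sigma> \<noteq> 0}"])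

lemma kchains_mono: "S \<subseteq> T \<Longrightarrow> kchains p (subtopology X S) \<subseteq> kchains p (subtopology X T)"
  by (auto simp: kchains_def singular_simplex_subtopology)

lemma kboundary_add:
  assumes "c \<in> kchains p X" "d \<in> kchains p X"
  shows "kboundary p (c + d) = kboundary p c + kboundary p d"
proof
  fix \<tau>
  define U where "U = {\<sigma>. c \<sigma> \<noteq> 0} \<union> {\<sigma>. d \<sigma> \<noteq> 0}"
  have U: "finite U" "{\<sigma>. c \<sigma> \<noteq> 0} \<subseteq> U" "{\<sigma>. d \<sigma> \<noteq> 0} \<subseteq> U" "{\<sigma>. (c + d) \<sigma> \<noteq> 0} \<subseteq> U"
    using assms by (auto simp: U_def kchains_def)
  show "kboundary p (c + d) \<tau> = (kboundary p c + kboundary p d) \<tau>"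
    by (simp add: kboundary_superset[OF U(1,2)] kboundary_superset[OF U(1,3)]
        kboundary_superset[OF U(1,4)] sum.distrib[symmetric])
      (auto intro!: sum.cong simp: algebra_simps)
qed

lemma kboundary_smult:
  assumes "c \<in> kchains p X"
  shows "kboundary p (\<lambda>\<sigma>. r * c \<sigma>) = (\<lambda>\<tau>. r * kboundary p c \<tau>)"
proof
  fix \<tau>
  have U: "finite {\<sigma>. c \<sigma> \<noteq> 0}" "{\<sigma>. r * c \<sigma> \<noteq> 0} \<subseteq> {\<sigma>. c \<sigma> \<noteq> 0}"
    using assms by (auto simp: kchains_def)
  show "kboundary p (\<lambda>\<sigma>. r * c \<sigma>) \<tau> = r * kboundary p c \<tau>"
    by (simp add: kboundary_superset[OF U] kboundary_superset[OF U(1) order_refl] sum_distrib_left)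
      (auto intro!: sum.cong)
qed

lemma kcycles_add: "c \<in> kcycles p X \<Longrightarrow> d \<in> kcycles p X \<Longrightarrow> c + d \<in> kcycles p X"
  by (auto simp: kcycles_def kchains_add kboundary_add)

lemma kcycles_smult: "c \<in> kcycles p X \<Longrightarrow> (\<lambda>\<sigma>. r * c \<sigma>) \<in> kcycles p X"
  by (auto simp: kcycles_def kchains_smult kboundary_smult)

lemma kcycles_zero: "(\<lambda>_. 0) \<in> kcycles p X"
  by (auto simp: kcycles_def kchains_def kboundary_def)

lemma kcycles_mono: "S \<subseteq> T \<Longrightarrow> kcycles p (subtopology X S) \<subseteq> kcycles p (subtopology X T)"
  using kchains_mono by (fastforce simp: kcycles_def)

lemma kbounds_add: "c \<in> kbounds p X \<Longrightarrow> d \<in> kbounds p X \<Longrightarrow> c + d \<in> kbounds p X"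
  unfolding kbounds_def by (auto simp: kboundary_add[symmetric] kchains_add)

lemma kbounds_smult: "c \<in> kbounds p X \<Longrightarrow> (\<lambda>\<sigma>. r * c \<sigma>) \<in> kbounds p X"
  unfolding kbounds_def by (auto simp: kboundary_smult[symmetric] kchains_smult)

lemma kbounds_zero: "0 \<in> kbounds p X"
  unfolding kbounds_def
  by (rule image_eqI[of _ _ 0]) (auto simp: kchains_def kboundary_def fun_eq_iff)

lemma kbounds_uminus: "c \<in> kbounds p X \<Longrightarrow> - c \<in> kbounds p X"
  using kbounds_smult[of c p X "-1"] by (simp add: fun_Compl_def)

lemma kbounds_mono: "S \<subseteq> T \<Longrightarrow> kbounds p (subtopology X S) \<subseteq> kbounds p (subtopology X T)"
  unfolding kbounds_def using kchains_mono by (intro image_mono)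

section \<open>Homology classes as cosets of boundaries\<close>

definition hclass :: "nat \<Rightarrow> 'a topology \<Rightarrow> ('a, 'k::field) kchain \<Rightarrow> ('a, 'k) kchain set" where
  "hclass q Y z = (+) z ` kbounds q Y"

lemma mem_hclass: "a \<in> hclass q Y z \<longleftrightarrow> a - z \<in> kbounds q Y"
proof
  assume "a - z \<in> kbounds q Y"
  then show "a \<in> hclass q Y z" unfolding hclass_def by (intro image_eqI[of _ _ "a - z"]) auto
qed (auto simp: hclass_def)

lemma khom_eq: "khom q Y = hclass q Y ` kcycles q Y"
  by (simp add: khom_def hclass_def)

lemma hclass_eqI:
  assumes "z - z' \<in> kbounds q Y" shows "hclass q Y z = hclass q Y z'"
proof (intro Set.set_eqI)
  fix a
  have "a - z' = (a - z) + (z - z')" "a - z = (a - z') + - (z - z')" by simp_all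
  then show "a \<in> hclass q Y z \<longleftrightarrow> a \<in> hclass q Y z'"
    unfolding mem_hclass using assms by (metis kbounds_add kbounds_uminus)
qed

text \<open>Allowing two spaces covers both uses of \<open>khom_add\<close>: addition when they
  coincide, and the map induced by an inclusion when \<open>z'\<close> is 0.\<close>

lemma khom_add_hclass:
  fixes z :: "('a, 'k::field) kchain"
  assumes "(kbounds q Y :: ('a, 'k) kchain set) \<subseteq> kbounds q Y'"
  shows "khom_add (hclass q Y z) (hclass q Y' z') = hclass q Y' (z + z')"
proof (intro Set.set_eqI iffI)
  fix x assume "x \<in> khom_add (hclass q Y z) (hclass q Y' z')"
  then obtain a a' where x: "x = a + a'" "a - z \<in> kbounds q Y'" "a' - z' \<in> kbounds q Y'"
    unfolding khom_add_def mem_hclass using assms by blast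
  have "x - (z + z') = (a - z) + (a' - z')" by (simp add: x algebra_simps)
  then show "x \<in> hclass q Y' (z + z')" using x by (simp only: mem_hclass kbounds_add)
next
  fix x assume x: "x \<in> hclass q Y' (z + z')"
  have "x = z + (x - z)" "z \<in> hclass q Y z" "x - z \<in> hclass q Y' z'"
    using x by (auto simp: mem_hclass kbounds_zero algebra_simps)
  then show "x \<in> khom_add (hclass q Y z) (hclass q Y' z')" unfolding khom_add_def by blast
qed

lemma khom_incl_hclass:
  fixes z :: "('a, 'k::field) kchain"
  assumes "(kbounds q Y :: ('a, 'k) kchain set) \<subseteq> kbounds q Y'"
  shows "khom_incl q Y' (hclass q Y z) = hclass q Y' z"
proof -
  have "(kbounds q Y' :: ('a, 'k) kchain set) = hclass q Y' 0" by (auto simp: mem_hclass)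
  then show ?thesis unfolding khom_incl_def using khom_add_hclass[OF assms, of z 0] by simp
qed

lemma khom_smult_hclass: "khom_smult q Y r (hclass q Y z) = hclass q Y (\<lambda>\<sigma>. r * z \<sigma>)"
proof (intro Set.set_eqI iffI)
  fix x assume "x \<in> khom_smult q Y r (hclass q Y z)"
  then obtain a w where x: "x = (\<lambda>\<sigma>. r * a \<sigma>) + w" "a - z \<in> kbounds q Y" "w \<in> kbounds q Y"
    unfolding khom_smult_def mem_hclass by blast
  have "x - (\<lambda>\<sigma>. r * z \<sigma>) = (\<lambda>\<sigma>. r * (a - z) \<sigma>) + w" by (auto simp: x algebra_simps)
  then show "x \<in> hclass q Y (\<lambda>\<sigma>. r * z \<sigma>)"
    using x by (simp only: mem_hclass kbounds_add kbounds_smult)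
next
  fix x assume x: "x \<in> hclass q Y (\<lambda>\<sigma>. r * z \<sigma>)"
  have "x = (\<lambda>\<sigma>. r * z \<sigma>) + (x - (\<lambda>\<sigma>. r * z \<sigma>))" "z \<in> hclass q Y z"
    "x - (\<lambda>\<sigma>. r * z \<sigma>) \<in> kbounds q Y"
    using x by (auto simp: mem_hclass kbounds_zero)
  then show "x \<in> khom_smult q Y r (hclass q Y z)" unfolding khom_smult_def by blast
qed

section \<open>Sublevel sets and their inclusions\<close>

abbreviation sublevel_top :: "'a topology \<Rightarrow> ('a \<Rightarrow> bpt) \<Rightarrow> ('a \<Rightarrow> bpt) \<Rightarrow> bpt \<Rightarrow> 'a topology" where
  "sublevel_top X f1 f2 b \<equiv> subtopology X (sublevel X f1 f2 b)"

lemma sublevel_mono: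
  assumes "bipath_function X f1 f2" "ble b b'"
  shows "sublevel X f1 f2 b \<subseteq> sublevel X f1 f2 b'"
proof -
  \<comment> \<open>The sublevel set at the bottom is defined through \<open>f1\<close>; including
    it in the second arm relies on the common preimage of \<open>MInf\<close>.\<close>
  have m: "f2 x = MInf" if "x \<in> topspace X" "f1 x = MInf" for x
    using assms(1) that by (auto simp: bipath_function_def)
  have t: "ble x z" if "ble x y" "ble y z" for x y z
    using that by (cases x; cases y; cases z) auto
  show ?thesis
  proof (cases b; cases b')
    fix r i s j assume "b = Pt r i" "b' = Pt s j"
    then show ?thesis using assms(2) t
      by (cases i) (auto simp: sublevel_def intro: t)
  qed (use assms(2) m in \<open>auto simp: sublevel_def split: bidx.splits\<close>)
qed

lemma bdist_le_ble:
  assumes "bdist x y \<le> ennreal e" "e \<ge> 0" "ble x b"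
  shows "ble y (shift e b)"
  using assms by (cases x; cases y; cases b) (auto simp: top_unique split: if_splits)

lemma sublevel_shift:
  assumes "\<And>x. x \<in> topspace X \<Longrightarrow> bdist (f1 x) (g1 x) \<le> ennreal e"
    "\<And>x. x \<in> topspace X \<Longrightarrow> bdist (f2 x) (g2 x) \<le> ennreal e" "e \<ge> 0"
  shows "sublevel X f1 f2 b \<subseteq> sublevel X g1 g2 (shift e b)"
proof -
  have "g1 x = MInf" if "x \<in> topspace X" "f1 x = MInf" for x
    using bdist_le_ble[OF assms(1)[OF that(1)] assms(3), of MInf] that by simp
  moreover have "ble (g1 x) (Pt (r + e) i)" if "x \<in> topspace X" "ble (f1 x) (Pt r i)" for x r i
    using bdist_le_ble[OF assms(1)[OF that(1)] assms(3) that(2)] by simp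
  moreover have "ble (g2 x) (Pt (r + e) i)" if "x \<in> topspace X" "ble (f2 x) (Pt r i)" for x r i
    using bdist_le_ble[OF assms(2)[OF that(1)] assms(3) that(2)] by simp
  ultimately show ?thesis
    by (cases b) (auto simp: sublevel_def split: bidx.splits)
qed

section \<open>Barcode coordinates of cycles\<close>

locale barcode_iso =
  fixes q :: nat and X :: "'a topology" and f1 f2 :: "'a \<Rightarrow> bpt" and m :: "bpt set \<Rightarrow> nat"
    and \<phi> :: "bpt \<Rightarrow> ('a, 'k::field) kchain set \<Rightarrow> (bpt set \<times> nat \<Rightarrow> 'k)"
  assumes bipath: "bipath_function X f1 f2"
    and bij: "bij_betw (\<phi> b) (khom q (sublevel_top X f1 f2 b)) (dsum_space m b)"
    and add: "x \<in> khom q (sublevel_top X f1 f2 b) \<Longrightarrow> y \<in> khom q (sublevel_top X f1 f2 b) \<Longrightarrow>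
      \<phi> b (khom_add x y) = \<phi> b x + \<phi> b y"
    and smult: "x \<in> khom q (sublevel_top X f1 f2 b) \<Longrightarrow>
      \<phi> b (khom_smult q (sublevel_top X f1 f2 b) r x) = (\<lambda>p. r * \<phi> b x p)"
    and incl: "ble b b' \<Longrightarrow> x \<in> khom q (sublevel_top X f1 f2 b) \<Longrightarrow>
      \<phi> b' (khom_incl q (sublevel_top X f1 f2 b') x) = dsum_map b b' (\<phi> b x)"
begin

abbreviation T :: "bpt \<Rightarrow> 'a topology" where
  "T \<equiv> sublevel_top X f1 f2"

text \<open>Coordinates are attached to cycles rather than to classes, so that a map induced by an
  inclusion leaves the representative unchanged.\<close>

definition coord_vec :: "bpt \<Rightarrow> ('a, 'k) kchain \<Rightarrow> (bpt set \<times> nat \<Rightarrow> 'k)" where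
  "coord_vec b z = \<phi> b (hclass q (T b) z)"

lemma hclass_mem: "z \<in> kcycles q (T b) \<Longrightarrow> hclass q (T b) z \<in> khom q (T b)"
  by (simp add: khom_eq)

lemma coord_vec_mem: "z \<in> kcycles q (T b) \<Longrightarrow> coord_vec b z \<in> dsum_space m b"
  unfolding coord_vec_def by (intro bij_betw_apply[OF bij] hclass_mem)

lemma coord_vec_surj:
  assumes "x \<in> dsum_space m b"
  obtains z where "z \<in> kcycles q (T b)" "x = coord_vec b z"
proof -
  have "x \<in> \<phi> b ` khom q (T b)" using assms bij[of b] by (simp add: bij_betw_def)
  then show thesis using that unfolding khom_eq coord_vec_def by blast
qed

lemma coord_vec_add:
  assumes "z \<in> kcycles q (T b)" "w \<in> kcycles q (T b)"
  shows "coord_vec b (z + w) = coord_vec b z + coord_vec b w"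
  using add[OF hclass_mem[OF assms(1)] hclass_mem[OF assms(2)]] by (simp add: coord_vec_def khom_add_hclass)

lemma coord_vec_smult:
  assumes "z \<in> kcycles q (T b)"
  shows "coord_vec b (\<lambda>\<sigma>. r * z \<sigma>) = (\<lambda>p. r * coord_vec b z p)"
  using smult[OF hclass_mem[OF assms], of r] by (simp add: coord_vec_def khom_smult_hclass)

lemma coord_vec_incl:
  assumes "ble b b'" "z \<in> kcycles q (T b)"
  shows "coord_vec b' z = dsum_map b b' (coord_vec b z)"
  using incl[OF assms(1) hclass_mem[OF assms(2)]]
  unfolding coord_vec_def khom_incl_hclass[OF kbounds_mono[OF sublevel_mono[OF bipath assms(1)]]] .

lemma coord_vec_eqI: "z - w \<in> kbounds q (T b) \<Longrightarrow> coord_vec b z = coord_vec b w"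
  unfolding coord_vec_def by (simp add: hclass_eqI)

lemma inv_vec:
  assumes "z \<in> kcycles q (T b)"
  shows "inv_into (khom q (T b)) (\<phi> b) (coord_vec b z) = hclass q (T b) z"
  unfolding coord_vec_def using bij[of b] hclass_mem[OF assms] by (simp add: bij_betw_def inv_into_f_f)

lemma coord_vec_sum:
  assumes "finite F" "F \<subseteq> kcycles q (T b)"
  shows "(\<Sum>s\<in>F. (\<lambda>\<sigma>. c s * s \<sigma>)) \<in> kcycles q (T b) \<and>
    coord_vec b (\<Sum>s\<in>F. (\<lambda>\<sigma>. c s * s \<sigma>)) p = (\<Sum>s\<in>F. c s * coord_vec b s p)"
  using assms
proof (induction F rule: finite_induct)
  case empty
  then show ?case using kcycles_zero coord_vec_smult[OF kcycles_zero, of b 0] by (simp add: zero_fun_def)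
next
  case (insert s F)
  then have s: "s \<in> kcycles q (T b)" by auto
  note cs = kcycles_smult[OF s, of "c s"]
  have IH: "(\<Sum>s\<in>F. (\<lambda>\<sigma>. c s * s \<sigma>)) \<in> kcycles q (T b)"
    "coord_vec b (\<Sum>s\<in>F. (\<lambda>\<sigma>. c s * s \<sigma>)) p = (\<Sum>s\<in>F. c s * coord_vec b s p)"
    using insert.IH insert.prems by auto
  have "coord_vec b ((\<lambda>\<sigma>. c s * s \<sigma>) + (\<Sum>s\<in>F. (\<lambda>\<sigma>. c s * s \<sigma>))) p =
    c s * coord_vec b s p + coord_vec b (\<Sum>s\<in>F. (\<lambda>\<sigma>. c s * s \<sigma>)) p"
    by (simp add: coord_vec_add[OF cs IH(1)] coord_vec_smult[OF s])
  then show ?case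
    unfolding sum.insert[OF insert.hyps] using kcycles_add[OF cs IH(1)] IH(2) by (simp only: simp_thms)
qed

text \<open>Homology at \<open>b\<close> is spanned by finitely many cycles, each with a finitely
  supported coordinate vector. The unit vector of every live index is a combination of these, so the
  index lies in one of their supports.\<close>

lemma finite_at:
  assumes tm: "tame TYPE('k) q X f1 f2"
  shows "finite {p \<in> melems m. b \<in> fst p}"
proof -
  have "khom_findim q (T b) TYPE('k)" using tm by (simp add: tame_def)
  then obtain F where F: "F \<subseteq> (kcycles q (T b) :: ('a, 'k) kchain set)" "finite F"
    "\<forall>z \<in> kcycles q (T b). \<exists>c. z - (\<Sum>s\<in>F. (\<lambda>\<sigma>. c s * s \<sigma>)) \<in> kbounds q (T b)"
    unfolding khom_findim_def by blast
  have "{p \<in> melems m. b \<in> fst p} \<subseteq> (\<Union>s\<in>F. {p. coord_vec b s p \<noteq> 0})"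
  proof
    fix p assume p: "p \<in> {p \<in> melems m. b \<in> fst p}"
    have "(unit_vec p :: _ \<Rightarrow> 'k) \<in> dsum_space m b" using p by (simp add: unit_vec_dsum)
    then obtain z where z: "z \<in> kcycles q (T b)" "unit_vec p = coord_vec b z" by (rule coord_vec_surj)
    obtain c where c: "z - (\<Sum>s\<in>F. (\<lambda>\<sigma>. c s * s \<sigma>)) \<in> kbounds q (T b)" using F(3) z(1) by blast
    have "(\<Sum>s\<in>F. c s * coord_vec b s p) = unit_vec p p"
      using coord_vec_sum[OF F(2,1), of c p] coord_vec_eqI[OF c] z(2) by simp
    then have "(\<Sum>s\<in>F. c s * coord_vec b s p) \<noteq> 0" by (simp add: unit_vec_def)
    then obtain s where "s \<in> F" "c s * coord_vec b s p \<noteq> 0"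
      using sum.not_neutral_contains_not_neutral by blast
    then show "p \<in> (\<Union>s\<in>F. {p. coord_vec b s p \<noteq> 0})" by auto
  qed
  moreover have "finite {p. coord_vec b s p \<noteq> 0}" if "s \<in> F" for s
    using coord_vec_mem[of s b] F(1) that by (auto simp: dsum_space_def)
  ultimately show ?thesis using F(2) by (meson finite_UN finite_subset)
qed

end

lemma barcode_ofE:
  assumes "barcode_of TYPE('k::field) q X f1 f2 m" "bipath_function X f1 f2"
  obtains \<phi> :: "bpt \<Rightarrow> ('a, 'k::field) kchain set \<Rightarrow> (bpt set \<times> nat \<Rightarrow> 'k)"
  where "barcode_iso q X f1 f2 m \<phi>" "\<And>I. m I > 0 \<Longrightarrow> binterval I"
proof -
  from assms(1) obtain \<phi> :: "bpt \<Rightarrow> ('a, 'k) kchain set \<Rightarrow> (bpt set \<times> nat \<Rightarrow> 'k)" where \<phi>: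
    "(\<forall>b. bij_betw (\<phi> b) (Vf_space q X f1 f2 b) (dsum_space m b)) \<and>
        (\<forall>b. \<forall>x\<in>Vf_space q X f1 f2 b. \<forall>y\<in>Vf_space q X f1 f2 b. \<phi> b (Vf_add b x y) = \<phi> b x + \<phi> b y) \<and>
        (\<forall>b. \<forall>r. \<forall>x\<in>Vf_space q X f1 f2 b. \<phi> b (Vf_smult q X f1 f2 b r x) = (\<lambda>p. r * \<phi> b x p)) \<and>
        (\<forall>b b'. ble b b' \<longrightarrow> (\<forall>x\<in>Vf_space q X f1 f2 b.
          \<phi> b' (Vf_map q X f1 f2 b b' x) = dsum_map b b' (\<phi> b x)))"
    and int: "\<forall>I. m I > 0 \<longrightarrow> binterval I"
    unfolding barcode_of_def is_barcode_def by (elim conjE exE) (rule that; (intro conjI)?; assumption)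
  have "barcode_iso q X f1 f2 m \<phi>"
    by unfold_locales
      (use assms(2) \<phi> in \<open>simp_all add: Vf_space_def Vf_add_def Vf_smult_def Vf_map_def\<close>)
  then show thesis using that int by blast
qed

section \<open>The interleaving by inclusions, in barcode coordinates\<close>

definition incl_morphism where
  "incl_morphism e q X f1 f2 \<phi> g1 g2 \<psi> b x = \<psi> (shift e b)
     (khom_incl q (sublevel_top X g1 g2 (shift e b)) (inv_into (khom q (sublevel_top X f1 f2 b)) (\<phi> b) x))"

lemma incl_morphism_vec:
  assumes F: "barcode_iso q X f1 f2 m \<phi>" and G: "barcode_iso q X g1 g2 n \<psi>"
    and sub: "sublevel X f1 f2 b \<subseteq> sublevel X g1 g2 (shift e b)"
    and z: "z \<in> kcycles q (sublevel_top X f1 f2 b)"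
  shows "incl_morphism e q X f1 f2 \<phi> g1 g2 \<psi> b (barcode_iso.coord_vec q X f1 f2 \<phi> b z) =
    barcode_iso.coord_vec q X g1 g2 \<psi> (shift e b) z"
proof -
  interpret F: barcode_iso q X f1 f2 m \<phi> by (rule F)
  interpret G: barcode_iso q X g1 g2 n \<psi> by (rule G)
  show ?thesis
    unfolding incl_morphism_def F.inv_vec[OF z] khom_incl_hclass[OF kbounds_mono[OF sub]]
    by (simp add: G.coord_vec_def)
qed

lemma shift_morphism_incl:
  fixes \<phi> \<psi> :: "bpt \<Rightarrow> ('a, 'k::field) kchain set \<Rightarrow> (bpt set \<times> nat \<Rightarrow> 'k)"
  assumes F: "barcode_iso q X f1 f2 m \<phi>" and G: "barcode_iso q X g1 g2 n \<psi>"
    and sub: "\<And>b. sublevel X f1 f2 b \<subseteq> sublevel X g1 g2 (shift e b)"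
  shows "shift_morphism e m n (incl_morphism e q X f1 f2 \<phi> g1 g2 \<psi>)"
proof -
  interpret F: barcode_iso q X f1 f2 m \<phi> by (rule F)
  interpret G: barcode_iso q X g1 g2 n \<psi> by (rule G)
  note inc = incl_morphism_vec[OF F G sub]
  have Z: "z \<in> kcycles q (G.T (shift e b))" if "z \<in> kcycles q (F.T b)" for z b
    using that kcycles_mono[OF sub] by blast
  show ?thesis
  proof
    fix x :: "bpt set \<times> nat \<Rightarrow> 'k" and b assume x: "x \<in> dsum_space m b"
    \<comment> \<open>Once \<open>x\<close> is represented by a cycle, the morphism keeps that cycle
      and only changes the sublevel set, so each property reduces to its counterpart for
      \<open>coord_vec\<close>.\<close>
    obtain z where z: "z \<in> kcycles q (F.T b)" "x = F.coord_vec b z" using x by (rule F.coord_vec_surj)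
    show "incl_morphism e q X f1 f2 \<phi> g1 g2 \<psi> b x \<in> dsum_space n (shift e b)"
      unfolding z(2) inc[OF z(1)] by (rule G.coord_vec_mem[OF Z[OF z(1)]])
    show "incl_morphism e q X f1 f2 \<phi> g1 g2 \<psi> b (\<lambda>p. r * x p) =
      (\<lambda>q'. r * incl_morphism e q X f1 f2 \<phi> g1 g2 \<psi> b x q')" for r
      unfolding z(2) F.coord_vec_smult[OF z(1), symmetric] inc[OF z(1)] inc[OF kcycles_smult[OF z(1)]]
      by (rule G.coord_vec_smult[OF Z[OF z(1)]])
    show "incl_morphism e q X f1 f2 \<phi> g1 g2 \<psi> b (x + y) =
      incl_morphism e q X f1 f2 \<phi> g1 g2 \<psi> b x + incl_morphism e q X f1 f2 \<phi> g1 g2 \<psi> b y"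
      if y: "y \<in> dsum_space m b" for y :: "bpt set \<times> nat \<Rightarrow> 'k"
    proof -
      obtain w where w: "w \<in> kcycles q (F.T b)" "y = F.coord_vec b w" using y by (rule F.coord_vec_surj)
      show ?thesis
        unfolding z(2) w(2) F.coord_vec_add[OF z(1) w(1), symmetric] inc[OF z(1)] inc[OF w(1)]
          inc[OF kcycles_add[OF z(1) w(1)]]
        by (rule G.coord_vec_add[OF Z[OF z(1)] Z[OF w(1)]])
    qed
    show "incl_morphism e q X f1 f2 \<phi> g1 g2 \<psi> b' (dsum_map b b' x) =
      dsum_map (shift e b) (shift e b') (incl_morphism e q X f1 f2 \<phi> g1 g2 \<psi> b x)"
      if le: "ble b b'" for b'
    proof -
      have z': "z \<in> kcycles q (F.T b')"
        using z(1) kcycles_mono[OF sublevel_mono[OF F.bipath le]] by blast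
      show ?thesis
        unfolding z(2) F.coord_vec_incl[OF le z(1), symmetric] inc[OF z(1)] inc[OF z']
        by (rule G.coord_vec_incl[OF ble_shift[OF le] Z[OF z(1)]])
    qed
  qed
qed

text \<open>Both sides are the coordinate vector of one cycle, viewed in the sublevel set of
  \<open>f\<close> at the point shifted by \<open>2 * e\<close>.\<close>

lemma incl_morphism_comp:
  fixes \<phi> \<psi> :: "bpt \<Rightarrow> ('a, 'k::field) kchain set \<Rightarrow> (bpt set \<times> nat \<Rightarrow> 'k)"
  assumes F: "barcode_iso q X f1 f2 m \<phi>" and G: "barcode_iso q X g1 g2 n \<psi>" and e: "e \<ge> 0"
    and sub: "\<And>b. sublevel X f1 f2 b \<subseteq> sublevel X g1 g2 (shift e b)"
      "\<And>b. sublevel X g1 g2 b \<subseteq> sublevel X f1 f2 (shift e b)"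
    and x: "x \<in> dsum_space m b"
  shows "incl_morphism e q X g1 g2 \<psi> f1 f2 \<phi> (shift e b) (incl_morphism e q X f1 f2 \<phi> g1 g2 \<psi> b x) =
    dsum_map b (shift (2 * e) b) x"
proof -
  interpret F: barcode_iso q X f1 f2 m \<phi> by (rule F)
  interpret G: barcode_iso q X g1 g2 n \<psi> by (rule G)
  obtain z where z: "z \<in> kcycles q (F.T b)" "x = F.coord_vec b z" using x by (rule F.coord_vec_surj)
  have Z: "z \<in> kcycles q (G.T (shift e b))" using z(1) kcycles_mono[OF sub(1)] by blast
  have le: "ble b (shift (2 * e) b)" using e by (cases b) auto
  show ?thesis
    unfolding z(2) incl_morphism_vec[OF F G sub(1) z(1)] incl_morphism_vec[OF G F sub(2) Z]
    using F.coord_vec_incl[OF le z(1)] by simp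
qed

theorem theorem4p1:
  fixes X :: "'a topology" and q :: nat
    and f1 f2 g1 g2 :: "'a \<Rightarrow> bpt"
    and mf mg :: "bpt set \<Rightarrow> nat"
  assumes "bipath_function X f1 f2" and "bipath_function X g1 g2"
    and "tame TYPE('k::field) q X f1 f2" and "tame TYPE('k) q X g1 g2"
    and "{x\<in>topspace X. f1 x = MInf} = {x\<in>topspace X. g1 x = MInf}"
    and "barcode_of TYPE('k) q X f1 f2 mf" and "barcode_of TYPE('k) q X g1 g2 mg"
  shows "dB TYPE('k) mf mg \<le> fdist X f1 f2 g1 g2"
\<comment> \<open>This rule disposes of an infinite distance and grants a slack \<open>d\<close>,
  the room that \<open>lam_matching_if_interleaved\<close> requires above \<open>e\<close>.\<close>
proof (rule ennreal_le_epsilon)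
  fix d :: real assume fin: "fdist X f1 f2 g1 g2 < Orderings.top" and d: "0 < d"
  define e where "e = enn2real (fdist X f1 f2 g1 g2)"
  have e: "e \<ge> 0" "fdist X f1 f2 g1 g2 = ennreal e" using fin by (auto simp: e_def)
  have dist: "bdist (f1 x) (g1 x) \<le> ennreal e" "bdist (f2 x) (g2 x) \<le> ennreal e"
    if "x \<in> topspace X" for x
    unfolding e(2)[symmetric] fdist_def
    by (rule max.coboundedI1 max.coboundedI2, rule SUP_upper[OF that])+
  have bdist_commute: "bdist x y = bdist y x" for x y
    by (cases x; cases y) (auto simp: abs_minus_commute)
  have sub: "sublevel X f1 f2 b \<subseteq> sublevel X g1 g2 (shift e b)"
    "sublevel X g1 g2 b \<subseteq> sublevel X f1 f2 (shift e b)" for b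
    by (rule sublevel_shift; use dist e bdist_commute in simp)+
  obtain \<phi> :: "bpt \<Rightarrow> ('a, 'k) kchain set \<Rightarrow> _" where F: "barcode_iso q X f1 f2 mf \<phi>"
    and f_int: "\<And>I. mf I > 0 \<Longrightarrow> binterval I"
    using barcode_ofE[OF assms(6,1)] by blast
  obtain \<psi> :: "bpt \<Rightarrow> ('a, 'k) kchain set \<Rightarrow> _" where G: "barcode_iso q X g1 g2 mg \<psi>"
    and g_int: "\<And>I. mg I > 0 \<Longrightarrow> binterval I"
    using barcode_ofE[OF assms(7,2)] by blast
  note FG = shift_morphism_incl[OF F G sub(1)] and GF = shift_morphism_incl[OF G F sub(2)]
  have "lam_matching TYPE('k) (e + d) mf mg"
  proof (rule lam_matching_if_interleaved)
    show "shift_matrix_inverse e mf mg (shift_morphism.entry mf (incl_morphism e q X f1 f2 \<phi> g1 g2 \<psi>))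
        (shift_morphism.entry mg (incl_morphism e q X g1 g2 \<psi> f1 f2 \<phi>))"
      by (rule shift_matrix_inverse_entry[OF FG GF e(1) f_int g_int barcode_iso.finite_at[OF G assms(4)]
            incl_morphism_comp[OF F G e(1) sub]])
    show "shift_matrix_inverse e mg mf (shift_morphism.entry mg (incl_morphism e q X g1 g2 \<psi> f1 f2 \<phi>))
        (shift_morphism.entry mf (incl_morphism e q X f1 f2 \<phi> g1 g2 \<psi>))"
      by (rule shift_matrix_inverse_entry[OF GF FG e(1) g_int f_int barcode_iso.finite_at[OF F assms(3)]
            incl_morphism_comp[OF G F e(1) sub(2,1)]])
    show "e < e + d" using d by simp
  qed
  then have "dB TYPE('k) mf mg \<le> ennreal (e + d)"
    unfolding dB_def using e d by (intro Inf_lower) (auto intro!: exI[of _ "e + d"])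
  then show "dB TYPE('k) mf mg \<le> fdist X f1 f2 g1 g2 + ennreal d"
    using e d by (simp)
qed

end
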